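(* Let $N\ge2$ be an integer, $\mu>0$, and consider the continuous-time $(\mu,(c_j),N)$-random walk on $\Omega_N$, started at $0$, where $\inf_jc_j>0$ and $\lim_{j\to\infty}c_{j+1}/c_j=1$. Then: (a) the degree of the random walk is $\gamma=\mu-1$, and it is $\gamma^+$ if and only if $\sum_j c_j^{-\mu}<\infty$; (b) if $\mu<1$, then the return time $T$ to $0$ has all moments of order less than $1-\mu$; (c) if $\mu=1$, then the return time $T$ to $0$ has no moments of positive order, i.e. $\mathbb E\,T^\delta=\infty$ for all $\delta>0$.
   Context: $\Omega_N=\{x=(x_1,x_2,\dots): x_i\in\mathbb Z_N,\ x_i\ne0 \text{ for only finitely many } i\}$ with $\mathbb Z_N$ the cyclic group of order $N$ and componentwise addition mod $N$; $|x|=\max\{i:x_i\ne0\}$ for $x\neq 0$ and $|0|=0$. Given a probability distribution $(r_j)_{j\ge1}$ on $\{1,2,\dots\}$ with all $r_j>0$, the $r_j$-random walk on $\Omega_N$ has i.i.d. steps $\eta$ with $\mathbb P[\eta=y]=\frac{r_{|y|}}{N^{|y|-1}(N-1)}$ for $y\neq0$ and $\mathbb P[\eta=0]=0$; its continuous-time version $X$ has unit-rate exponential holding times and transition probability $p_t(x,y)$. For a positive sequence $(c_j)_{j\ge0}$ with $\sum_j c_jN^{-j/\mu}<\infty$, the $(\mu,(c_j),N)$-random walk is the $r_j$-random walk with $r_j=D\,c_{j-1}N^{-(j-1)/\mu}$, $j\ge1$, $D$ being the normalizing constant. With $G^{\zeta}\varphi=\frac1{\Gamma(\zeta)}\int_0^\infty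 t^{\zeta-1}T_t\varphi\,dt$ ($\zeta>0$, $T_t$ the semigroup), the degree is $\gamma=\sup\{\zeta>-1:G^{\zeta+1}\varphi<\infty$ for all finitely supported $\varphi\ge0\}$; by irreducibility $G^{\zeta+1}\varphi<\infty$ for all such $\varphi$ iff $\int_0^\infty t^{\zeta}p_t(0,0)\,dt<\infty$. The degree is said to be $\gamma^+$ if $G^{\gamma+1}\varphi<\infty$ for all such $\varphi$, and $\gamma^-$ if $G^{\gamma+1}\varphi\equiv\infty$ for all such $\varphi\neq0$. With $H=\inf\{t>0:X_t\neq0\}$, the return time to $0$ is $T=\inf\{t>H:X_t=0\}$ ($=\infty$ if there is no return). *)

theory Defs
  imports "HOL-Probability.Probability" "HOL-Algebra.Product_Groups"
begin

section \<open>The hierarchical group\<close>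

text \<open>Coordinates are indexed by \<open>1, 2, \<dots>\<close>; elements of the carrier are \<open>undefined\<close> at \<open>0\<close>.\<close>

definition hier_group :: "nat \<Rightarrow> (nat \<Rightarrow> int) monoid" where
  "hier_group N = sum_group {1..} (\<lambda>_. integer_mod_group N)"

lemma carrier_hier_group:
  assumes "N \<ge> 1"
  shows "carrier (hier_group N) = {x \<in> {1..} \<rightarrow>\<^sub>E {0..<int N}. finite {i \<in> {1..}. x i \<noteq> 0}}"
  using assms by (simp add: hier_group_def carrier_sum_group carrier_integer_mod_group)

definition hier_abs :: "(nat \<Rightarrow> int) \<Rightarrow> nat" where
  "hier_abs x = (if \<forall>i\<ge>1. x i = 0 then 0 else Max {i. i \<ge> 1 \<and> x i \<noteq> 0})"

section \<open>The continuous-time random walk\<close>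

text \<open>The value of \<open>r\<close> at \<open>0\<close> is never used.\<close>

definition step_prob :: "nat \<Rightarrow> (nat \<Rightarrow> real) \<Rightarrow> (nat \<Rightarrow> int) \<Rightarrow> real" where
  "step_prob N r y =
     (if y = \<one>\<^bsub>hier_group N\<^esub> then 0
      else r (hier_abs y) / (real N ^ (hier_abs y - 1) * (real N - 1)))"

text \<open>The driving data of a walk: i.i.d. unit-rate holding times and i.i.d. steps, the two families
  being independent of each other. This joint independence is expressed by requiring that the
  pairs (holding time, step) are independent and that the two entries of each pair are independent.\<close>

locale hierarchical_walk = prob_space M
  for M :: "'w measure" and N :: nat and r :: "nat \<Rightarrow> real"
    and hold :: "nat \<Rightarrow> 'w \<Rightarrow> real" and step :: "nat \<Rightarrow> 'w \<Rightarrow> nat \<Rightarrow> int" +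
  assumes r_pos: "\<And>j. j \<ge> 1 \<Longrightarrow> r j > 0"
    and r_sums: "(\<lambda>j. r (Suc j)) sums 1"
    and hold_distributed: "\<And>k. distributed M lborel (hold k) (exponential_density 1)"
    and step_measurable: "\<And>k. step k \<in> measurable M (count_space (carrier (hier_group N)))"
    and step_distribution:
      "\<And>k y. y \<in> carrier (hier_group N) \<Longrightarrow>
         prob {\<omega> \<in> space M. step k \<omega> = y} = step_prob N r y"
    and pairs_indep:
      "indep_vars (\<lambda>_. borel \<Otimes>\<^sub>M count_space (carrier (hier_group N)))
         (\<lambda>k \<omega>. (hold k \<omega>, step k \<omega>)) UNIV"
    and hold_step_indep:
      "\<And>k. indep_set {hold k -` A \<inter> space M | A. A \<in> sets borel}
              {step k -` B \<inter> space M | B. B \<subseteq> carrier (hier_group N)}"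

primrec jump_chain ::
    "nat \<Rightarrow> (nat \<Rightarrow> 'w \<Rightarrow> nat \<Rightarrow> int) \<Rightarrow> (nat \<Rightarrow> int) \<Rightarrow> nat \<Rightarrow> 'w \<Rightarrow> nat \<Rightarrow> int" where
  "jump_chain N step x 0 \<omega> = x"
| "jump_chain N step x (Suc n) \<omega> = jump_chain N step x n \<omega> \<otimes>\<^bsub>hier_group N\<^esub> step n \<omega>"

text \<open>The number of jumps up to time \<open>t\<close>; the \<open>n\<close>th jump (counting from \<open>0\<close>) takes place at time
  \<open>hold 0 + \<dots> + hold n\<close>. On the null event that the set is infinite the value is \<open>0\<close>.\<close>

definition jump_count :: "(nat \<Rightarrow> 'w \<Rightarrow> real) \<Rightarrow> real \<Rightarrow> 'w \<Rightarrow> nat" where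
  "jump_count hold t \<omega> = card {n. (\<Sum>k\<le>n. hold k \<omega>) \<le> t}"

definition walk ::
    "nat \<Rightarrow> (nat \<Rightarrow> 'w \<Rightarrow> real) \<Rightarrow> (nat \<Rightarrow> 'w \<Rightarrow> nat \<Rightarrow> int) \<Rightarrow> (nat \<Rightarrow> int) \<Rightarrow> real \<Rightarrow> 'w \<Rightarrow> nat \<Rightarrow> int"
  where "walk N hold step x t \<omega> = jump_chain N step x (jump_count hold t \<omega>) \<omega>"

definition trans_prob ::
    "'w measure \<Rightarrow> nat \<Rightarrow> (nat \<Rightarrow> 'w \<Rightarrow> real) \<Rightarrow> (nat \<Rightarrow> 'w \<Rightarrow> nat \<Rightarrow> int) \<Rightarrow>
     real \<Rightarrow> (nat \<Rightarrow> int) \<Rightarrow> (nat \<Rightarrow> int) \<Rightarrow> real" where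
  "trans_prob M N hold step t x y = measure M {\<omega> \<in> space M. walk N hold step x t \<omega> = y}"

definition mu_c_rate :: "real \<Rightarrow> (nat \<Rightarrow> real) \<Rightarrow> nat \<Rightarrow> nat \<Rightarrow> real" where
  "mu_c_rate \<mu> c N j =
     (1 / (\<Sum>i. c i * real N powr (- real i / \<mu>))) * c (j - 1) * real N powr (- real (j - 1) / \<mu>)"

section \<open>Degree of a transition function\<close>

text \<open>Here \<open>p t x y\<close> is a transition function on the countable state space \<open>S\<close>.\<close>

definition semigroup_op ::
    "(real \<Rightarrow> 'a \<Rightarrow> 'a \<Rightarrow> real) \<Rightarrow> 'a set \<Rightarrow> real \<Rightarrow> ('a \<Rightarrow> real) \<Rightarrow> 'a \<Rightarrow> ennreal" where
  "semigroup_op p S t \<phi> x = (\<integral>\<^sup>+ y. ennreal (p t x y) * ennreal (\<phi> y) \<partial>count_space S)"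

definition frac_potential ::
    "(real \<Rightarrow> 'a \<Rightarrow> 'a \<Rightarrow> real) \<Rightarrow> 'a set \<Rightarrow> real \<Rightarrow> ('a \<Rightarrow> real) \<Rightarrow> 'a \<Rightarrow> ennreal" where
  "frac_potential p S \<zeta> \<phi> x =
     ennreal (1 / Gamma \<zeta>) *
     (\<integral>\<^sup>+ t. ennreal (t powr (\<zeta> - 1)) * semigroup_op p S t \<phi> x * indicator {0<..} t \<partial>lborel)"

definition finite_potential ::
    "(real \<Rightarrow> 'a \<Rightarrow> 'a \<Rightarrow> real) \<Rightarrow> 'a set \<Rightarrow> real \<Rightarrow> bool" where
  "finite_potential p S \<zeta> \<longleftrightarrow>
     (\<forall>\<phi>. (\<forall>x\<in>S. \<phi> x \<ge> 0) \<and> finite {x \<in> S. \<phi> x \<noteq> 0} \<longrightarrow>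
        (\<forall>x\<in>S. frac_potential p S \<zeta> \<phi> x < \<infinity>))"

definition potential_degree :: "(real \<Rightarrow> 'a \<Rightarrow> 'a \<Rightarrow> real) \<Rightarrow> 'a set \<Rightarrow> ereal" where
  "potential_degree p S = Sup (ereal ` {\<zeta>. \<zeta> > -1 \<and> finite_potential p S (\<zeta> + 1)})"

definition potential_degree_plus :: "(real \<Rightarrow> 'a \<Rightarrow> 'a \<Rightarrow> real) \<Rightarrow> 'a set \<Rightarrow> real \<Rightarrow> bool" where
  "potential_degree_plus p S \<gamma> \<longleftrightarrow> potential_degree p S = ereal \<gamma> \<and> finite_potential p S (\<gamma> + 1)"

section \<open>Return time\<close>

text \<open>Infima are taken in \<open>[0, \<infinity>]\<close>, so that the infimum of the empty set is \<open>\<infinity>\<close>.\<close>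

definition exit_time :: "(real \<Rightarrow> 'w \<Rightarrow> 'a) \<Rightarrow> 'a \<Rightarrow> 'w \<Rightarrow> ennreal" where
  "exit_time X z \<omega> = (INF t\<in>{t. t > 0 \<and> X t \<omega> \<noteq> z}. ennreal t)"

definition return_time :: "(real \<Rightarrow> 'w \<Rightarrow> 'a) \<Rightarrow> 'a \<Rightarrow> 'w \<Rightarrow> ennreal" where
  "return_time X z \<omega> = (INF t\<in>{t. ennreal t > exit_time X z \<omega> \<and> X t \<omega> = z}. ennreal t)"

text \<open>Intended for orders \<open>\<delta> > 0\<close>, where \<open>\<infinity>\<close> to the power \<open>\<delta>\<close> is \<open>\<infinity>\<close>.\<close>

definition moment :: "'w measure \<Rightarrow> ('w \<Rightarrow> ennreal) \<Rightarrow> real \<Rightarrow> ennreal" where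
  "moment M Y \<delta> =
     (\<integral>\<^sup>+ \<omega>. (if Y \<omega> = \<infinity> then \<infinity> else ennreal (enn2real (Y \<omega>) powr \<delta>)) \<partial>M)"

end

theory Submission
  imports Defs
begin

text \<open>Convolution with the uniform distribution on a ball is a projection, so the function that is
  \<open>N - 1\<close> on the ball of radius \<open>k\<close>, \<open>-1\<close> on the rest of the ball of radius \<open>k + 1\<close> and \<open>0\<close>
  elsewhere is an eigenfunction of the jump chain, with an eigenvalue \<open>\<phi>\<^sub>k\<close> for which
  \<open>1 - \<phi>\<^sub>k\<close> is comparable to \<open>r\<^sub>k\<^sub>+\<^sub>1\<close>. Telescoping over \<open>k\<close> gives
  \<open>P(S\<^sub>n = 0) = \<Sum>\<^sub>k w\<^sub>k \<phi>\<^sub>k\<^sup>n\<close> and \<open>p\<^sub>t(0,0) = \<Sum>\<^sub>k w\<^sub>k exp (- (1 - \<phi>\<^sub>k) t)\<close> with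
  \<open>w\<^sub>k = (N - 1) / N\<^sup>k\<^sup>+\<^sup>1\<close>, so integrating against \<open>t\<^sup>s\<^sup>-\<^sup>1\<close> turns the degree into the
  convergence of \<open>\<Sum>\<^sub>k w\<^sub>k (1 - \<phi>\<^sub>k)\<^sup>-\<^sup>s\<close>.

  For the return time, the holding times can be replaced by their means up to constants, so only the
  index of the first return of the jump chain matters. With \<open>u\<^sub>k = P(S\<^sub>k = 0)\<close> and \<open>q\<^sub>n\<close> the probability of no
  return up to step \<open>n\<close>, decomposition at the last visit gives \<open>\<Sum>\<^sub>k\<^sub>\<le>\<^sub>n u\<^sub>k q\<^sub>n\<^sub>-\<^sub>k = 1\<close>. Hence
  \<open>q\<^sub>n \<Sum>\<^sub>k\<^sub>\<le>\<^sub>n u\<^sub>k \<le> 1\<close>, which yields the moments for \<open>\<mu> < 1\<close>, and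
  \<open>n \<le> (\<Sum>\<^sub>k\<^sub>\<le>\<^sub>n u\<^sub>k) (\<Sum>\<^sub>k\<^sub>\<le>\<^sub>n q\<^sub>k)\<close>; for \<open>\<mu> = 1\<close> the first factor grows slower than every power, while a
  finite moment of order \<open>\<delta>\<close> would bound the second one by a multiple of \<open>n\<^sup>1\<^sup>-\<^sup>\<delta>\<close>.\<close>

section \<open>Sequences and their partial sums\<close>

lemma summable_of_ratio_lim:
  fixes a :: "nat \<Rightarrow> real"
  assumes "\<And>k. a k > 0" and "(\<lambda>k. a (Suc k) / a k) \<longlonglongrightarrow> L" and "L < 1"
  shows "summable a"
proof -
  obtain \<rho> where \<rho>: "L < \<rho>" "\<rho> < 1" using dense[OF assms(3)] by blast
  have "eventually (\<lambda>k. a (Suc k) / a k < \<rho>) sequentially"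
    by (rule order_tendstoD(2)[OF assms(2) \<rho>(1)])
  then obtain K where K: "\<And>k. k \<ge> K \<Longrightarrow> a (Suc k) / a k < \<rho>"
    by (auto simp: eventually_sequentially)
  show ?thesis
  proof (rule summable_ratio_test[OF \<rho>(2)])
    fix n assume "n \<ge> K"
    with K[of n] assms(1)[of n] have "a (Suc n) < \<rho> * a n" by (simp add: divide_simps)
    then show "norm (a (Suc n)) \<le> \<rho> * norm (a n)"
      using assms(1)[of n] assms(1)[of "Suc n"] by simp
  qed
qed

text \<open>From some index on consecutive ratios stay below a fixed \<rho> < 1, so a tail is
  dominated by a geometric series with first term \<open>a k\<close>. For
  \<open>a k = r (Suc k)\<close> this makes the tails of the rate sequence comparable to their first
  terms.\<close>

lemma tail_sum_le_ratio:
  fixes a :: "nat \<Rightarrow> real"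
  assumes pos: "\<And>k. a k > 0" and lim: "(\<lambda>k. a (Suc k) / a k) \<longlonglongrightarrow> L" and "L < 1"
  shows "\<exists>A>0. \<forall>k. (\<Sum>j. a (j + k)) \<le> A * a k"
proof -
  obtain \<rho> where \<rho>: "L < \<rho>" "\<rho> < 1" using dense[OF assms(3)] by blast
  have "eventually (\<lambda>k. a (Suc k) / a k < \<rho>) sequentially"
    by (rule order_tendstoD(2)[OF lim \<rho>(1)])
  then obtain K where K: "\<And>k. k \<ge> K \<Longrightarrow> a (Suc k) / a k < \<rho>"
    by (auto simp: eventually_sequentially)
  have "0 < a (Suc K) / a K" using pos by simp
  with K[of K] have \<rho>0: "\<rho> > 0" by simp
  have summ: "summable a" by (rule summable_of_ratio_lim[OF assms])
  have step: "a (Suc k) \<le> \<rho> * a k" if "k \<ge> K" for k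
    using K[OF that] pos[of k] by (simp add: divide_simps)
  have geo: "a (j + k) \<le> \<rho> ^ j * a k" if "k \<ge> K" for j k
  proof (induction j)
    case (Suc j)
    have "a (Suc j + k) \<le> \<rho> * a (j + k)" using step[of "j + k"] that by simp
    also have "\<dots> \<le> \<rho> * (\<rho> ^ j * a k)" using Suc \<rho>0 by (intro mult_left_mono) auto
    finally show ?case by simp
  qed simp
  have "(\<Sum>j. a (j + k)) / a k \<le> 1 / (1 - \<rho>)" if "k \<ge> K" for k
  proof -
    have "(\<Sum>j. a (j + k)) \<le> (\<Sum>j. \<rho> ^ j * a k)"
      using geo[OF that] \<rho>0 \<rho> summ
      by (intro suminf_le summable_mult2 summable_geometric) (auto simp: summable_iff_shift)
    also have "\<dots> = (1 / (1 - \<rho>)) * a k"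
      using \<rho>0 \<rho> by (subst suminf_mult2[symmetric]) (auto simp: suminf_geometric)
    finally show ?thesis using pos[of k] by (simp add: pos_divide_le_eq)
  qed
  moreover have "(\<Sum>j. a (j + k)) / a k \<ge> 0" for k
    using pos summ by (intro divide_nonneg_pos suminf_nonneg) (auto simp: summable_iff_shift less_imp_le)
  \<comment> \<open>The bound so far holds only for k \<ge> K; boundedness of the whole sequence
    absorbs the finitely many smaller indices into one constant.\<close>
  ultimately have "Bseq (\<lambda>k. (\<Sum>j. a (j + k)) / a k)"
    by (intro BfunI[of _ "1 / (1 - \<rho>)"]) (auto simp: eventually_sequentially simp del: abs_divide)
  then obtain A where A: "A > 0" "\<And>k. norm ((\<Sum>j. a (j + k)) / a k) \<le> A" by (auto elim: BseqE)
  have "(\<Sum>j. a (j + k)) \<le> A * a k" for k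
  proof -
    have "(\<Sum>j. a (j + k)) / a k \<le> A" using A(2)[of k] by (simp del: abs_divide)
    then show ?thesis using pos[of k] by (simp add: divide_simps)
  qed
  with A(1) show ?thesis by blast
qed

text \<open>The inverse ratios converge, hence are bounded. This prevents
  \<open>1 - eigval k\<close> from dropping by more than a constant factor in one step, as
  \<open>partial_sums_lower\<close> requires.\<close>

lemma Suc_ge_ratio:
  fixes a :: "nat \<Rightarrow> real"
  assumes pos: "\<And>k. a k > 0" and lim: "(\<lambda>k. a (Suc k) / a k) \<longlonglongrightarrow> L" and "L > 0"
  shows "\<exists>\<kappa>>0. \<forall>k. \<kappa> * a k \<le> a (Suc k)"
proof -
  have "(\<lambda>k. inverse (a (Suc k) / a k)) \<longlonglongrightarrow> inverse L"
    using lim assms(3) by (intro tendsto_inverse) auto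
  then have "Bseq (\<lambda>k. inverse (a (Suc k) / a k))" by (intro convergent_imp_Bseq convergentI)
  then obtain A where A: "A > 0" "\<And>k. norm (inverse (a (Suc k) / a k)) \<le> A" by (auto elim: BseqE)
  have "(1 / A) * a k \<le> a (Suc k)" for k
    using A(2)[of k] A(1) pos[of k] pos[of "Suc k"] by (simp add: field_simps)
  with A(1) show ?thesis by (metis zero_less_divide_1_iff)
qed

lemma powr_ratio_lim:
  fixes a :: "nat \<Rightarrow> real"
  assumes pos: "\<And>k. a k > 0" and lim: "(\<lambda>k. a (Suc k) / a k) \<longlonglongrightarrow> L" and "L > 0" and "b > 0"
  shows "(\<lambda>k. (b ^ Suc k * a (Suc k) powr s) / (b ^ k * a k powr s)) \<longlonglongrightarrow> b * L powr s"
proof -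
  have "(b ^ Suc k * a (Suc k) powr s) / (b ^ k * a k powr s) = b * (a (Suc k) / a k) powr s" for k
    using pos[of k] pos[of "Suc k"] \<open>b > 0\<close> by (simp add: powr_divide)
  moreover have "(\<lambda>k. b * (a (Suc k) / a k) powr s) \<longlonglongrightarrow> b * L powr s"
    using assms by (intro tendsto_intros) auto
  ultimately show ?thesis by simp
qed

text \<open>The terms \<open>b ^ k * a k powr s\<close> have ratio limit below 1, so they are
  summable and in particular bounded.\<close>

lemma powr_le_of_ratio:
  fixes a :: "nat \<Rightarrow> real"
  assumes pos: "\<And>k. a k > 0" and lim: "(\<lambda>k. a (Suc k) / a k) \<longlonglongrightarrow> L" and "L > 0" and "b > 0"
    and "b * L powr s < 1"
  shows "\<exists>C>0. \<forall>k. a k powr s \<le> C * (1 / b) ^ k"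
proof -
  have "summable (\<lambda>k. b ^ k * a k powr s)"
    using assms by (intro summable_of_ratio_lim[OF _ powr_ratio_lim[OF assms(1-4)]]) (auto simp: less_imp_neq[symmetric])
  then have "Bseq (\<lambda>k. b ^ k * a k powr s)" 
    using summable_imp_Bseq by blast
  then obtain C where C: "C > 0" "\<And>k. norm (b ^ k * a k powr s) \<le> C" by (auto elim: BseqE)
  have "a k powr s \<le> C * (1 / b) ^ k" for k
    using C(2)[of k] \<open>b > 0\<close> by (simp add: field_simps power_divide)
  with C(1) show ?thesis by blast
qed

text \<open>Since \<bar>1 - l\<bar> \<le> 1, the numerator of the closed form is at most 2. The
  range up to 2 admits negative bases, which occur because \<open>eigval 0\<close> is
  negative.\<close>

lemma geometric_sum_le_inverse:
  fixes l :: real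
  assumes "0 < l" "l \<le> 2"
  shows "(\<Sum>k\<le>m. (1 - l) ^ k) \<le> 2 / l"
proof -
  have "\<bar>(1 - l) ^ Suc m\<bar> \<le> 1"
    unfolding power_abs using assms by (intro power_le_one) auto
  moreover have "(\<Sum>k\<le>m. (1 - l) ^ k) = (1 - (1 - l) ^ Suc m) / l"
    using assms by (simp add: sum_gp0)
  ultimately show ?thesis using assms by (auto intro!: divide_right_mono)
qed

text \<open>Interpolation: write z as the product of its powers \<epsilon> and 1 - \<epsilon> and
  bound each factor separately.\<close>

lemma min_le_powr_mult_powr:
  fixes x y :: real
  assumes "z \<ge> 0" "z \<le> x" "z \<le> y" "0 \<le> \<epsilon>" "\<epsilon> \<le> 1"
  shows "z \<le> x powr \<epsilon> * y powr (1 - \<epsilon>)"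
proof (cases "z = 0")
  case False
  then have "z = z powr \<epsilon> * z powr (1 - \<epsilon>)" using assms by (simp flip: powr_add)
  also have "\<dots> \<le> x powr \<epsilon> * y powr (1 - \<epsilon>)"
    using assms by (intro mult_mono powr_mono2) auto
  finally show ?thesis .
qed simp

text \<open>Summing over n first leaves, for each k, a geometric sum bounded both by m + 1 and by 2
  / l k. Interpolating the two bounds with exponents \<epsilon> and 1 - \<epsilon> gives a majorant
  that is summable over k by hypothesis.\<close>

lemma partial_sums_upper:
  fixes w l :: "nat \<Rightarrow> real"
  assumes w: "\<And>k. w k \<ge> 0" and l: "\<And>k. 0 < l k" "\<And>k. l k \<le> 2"
    and u: "\<And>n. (\<lambda>k. w k * (1 - l k) ^ n) sums u n"
    and \<epsilon>: "0 \<le> \<epsilon>" "\<epsilon> \<le> 1" and summ: "summable (\<lambda>k. w k * l k powr - (1 - \<epsilon>))"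
  shows "\<exists>C. \<forall>m. (\<Sum>n\<le>m. u n) \<le> C * real (Suc m) powr \<epsilon>"
proof (intro exI allI)
  fix m
  have b: "w k * (\<Sum>n\<le>m. (1 - l k) ^ n) \<le>
      w k * l k powr - (1 - \<epsilon>) * (2 powr (1 - \<epsilon>) * real (Suc m) powr \<epsilon>)" for k
  proof -
    \<comment> \<open>The maximum with 0 supplies the nonnegativity that the interpolation asks for,
      as 1 - l k may be negative.\<close>
    let ?z = "max 0 (\<Sum>n\<le>m. (1 - l k) ^ n)"
    have "(\<Sum>n\<le>m. (1 - l k) ^ n) \<le> (\<Sum>n\<le>m. 1)"
    proof (rule sum_mono)
      fix n
      have "\<bar>(1 - l k) ^ n\<bar> \<le> 1"
        unfolding power_abs using l[of k] by (intro power_le_one) auto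
      then show "(1 - l k) ^ n \<le> 1" by linarith
    qed
    then have "?z \<le> real (Suc m) powr \<epsilon> * (2 / l k) powr (1 - \<epsilon>)"
      using geometric_sum_le_inverse[OF l, of k m] l[of k] \<epsilon>
      by (intro min_le_powr_mult_powr) auto
    also have "\<dots> = l k powr - (1 - \<epsilon>) * (2 powr (1 - \<epsilon>) * real (Suc m) powr \<epsilon>)"
      by (simp only: powr_divide powr_minus_divide) simp
    finally have "w k * (\<Sum>n\<le>m. (1 - l k) ^ n) \<le> 
      w k * (l k powr - (1 - \<epsilon>) * (2 powr (1 - \<epsilon>) * real (Suc m) powr \<epsilon>))"
      by (intro mult_left_mono w) simp
    then show ?thesis by (simp add: mult_ac)
  qed
  have "(\<lambda>k. \<Sum>n\<le>m. w k * (1 - l k) ^ n) sums (\<Sum>n\<le>m. u n)"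
    by (intro sums_sum u)
  then have "(\<lambda>k. w k * (\<Sum>n\<le>m. (1 - l k) ^ n)) sums (\<Sum>n\<le>m. u n)"
    by (simp add: sum_distrib_left)
  then have "(\<Sum>n\<le>m. u n) \<le> (\<Sum>k. w k * l k powr - (1 - \<epsilon>)) * (2 powr (1 - \<epsilon>) * real (Suc m) powr \<epsilon>)"
    by (rule sums_le[OF b _ sums_mult2[OF summable_sums[OF summ]]])
  then show "(\<Sum>n\<le>m. u n) \<le> ((\<Sum>k. w k * l k powr - (1 - \<epsilon>)) * 2 powr (1 - \<epsilon>)) * real (Suc m) powr \<epsilon>"
    by (simp add: mult_ac)
qed

text \<open>A single well-chosen k suffices: the first j with l j at most 1 / (2 (m + 1)). By
  minimality and \<open>\<kappa> * l k \<le> l (Suc k)\<close>, l j is also at least a constant over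
  m + 1. Bernoulli then keeps (1 - l j) ^ (2 n) above 1/2 for 2 n \<le> m, and w j is at least of
  order (m + 1) to the power -s.\<close>

lemma partial_sums_lower:
  fixes w l :: "nat \<Rightarrow> real"
  assumes w: "\<And>k. w k \<ge> 0" and l: "\<And>k. 0 < l k" "\<And>k. l k \<le> 2" "l \<longlonglongrightarrow> 0"
    and \<kappa>: "\<kappa> > 0" "\<And>k. \<kappa> * l k \<le> l (Suc k)"
    and \<theta>: "\<theta> > 0" "\<And>k. \<theta> * l k powr s \<le> w k" and s: "s \<ge> 0"
    and u: "\<And>n. (\<lambda>k. w k * (1 - l k) ^ n) sums u n" and u0: "\<And>n. u n \<ge> 0"
  shows "\<exists>C>0. \<forall>m. C * real (Suc m) powr (1 - s) \<le> (\<Sum>n\<le>m. u n)"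
proof -
  \<comment> \<open>The minimum treats the cases j = 0 and j > 0 of the lower bound for l j
    together.\<close>
  define a where "a = min (l 0) \<kappa> / 4"
  have a: "a > 0" using l(1)[of 0] \<kappa> by (simp add: a_def)
  have "\<theta> * a powr s / 4 * real (Suc m) powr (1 - s) \<le> (\<Sum>n\<le>m. u n)" for m
  proof -
    define x where "x = 1 / (2 * real (Suc m))"
    have x: "0 < x" "x \<le> 1" by (auto simp: x_def)
    have "\<exists>k. l k \<le> x"
      using order_tendstoD(2)[OF l(3) x(1)] 
      by (auto simp: eventually_sequentially intro: less_imp_le)
    then obtain i where i: "l i \<le> x" ..
    define j where "j = (LEAST k. l k \<le> x)"
    have j: "l j \<le> x" unfolding j_def by (rule LeastI[of _ i]) (rule i)
    have jmin: "x < l k" if "k < j" for k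
      using not_less_Least[of k] that unfolding j_def by (metis not_le)
    have lj: "l j \<ge> 4 * a * x"
    proof (cases j)
      case 0
      have "4 * a \<le> l 0" by (simp add: a_def)
      then have "4 * a * x \<le> l 0 * 1" using x a l(1)[of 0] by (intro mult_mono) auto
      then show ?thesis using 0 by simp
    next
      case (Suc i)
      have "4 * a \<le> \<kappa>" by (simp add: a_def)
      then have "4 * a * x \<le> \<kappa> * l i"
        using jmin[of i] Suc x \<kappa>(1) by (intro mult_mono) auto
      also have "\<dots> \<le> l j" using \<kappa>(2)[of i] Suc by simp
      finally show ?thesis .
    qed
    have up: "u (2 * n) \<ge> w j / 2" if n: "2 * n \<le> m" for n
    proof -
      have nn: "w k * (1 - l k) ^ (2 * n) \<ge> 0" for k
        using w[of k] by (intro mult_nonneg_nonneg) (auto simp: power_mult)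
      have "1 + real (2 * n) * (- l j) \<le> (1 + (- l j)) ^ (2 * n)"
        using l(1,2)[of j] j x by (intro Bernoulli_inequality) auto
      moreover have "real (2 * n) * l j \<le> 1 / 2"
      proof -
        have "real (2 * n) * l j \<le> real (Suc m) * x"
          using n j l(1)[of j] by (intro mult_mono) auto
        also have "\<dots> = 1 / 2" by (simp add: x_def field_simps)
        finally show ?thesis .
      qed
      ultimately have "1 / 2 \<le> (1 - l j) ^ (2 * n)" by simp
      then have "w j * (1 / 2) \<le> w j * (1 - l j) ^ (2 * n)" by (intro mult_left_mono w)
      also have "\<dots> = (\<Sum>k\<in>{j}. w k * (1 - l k) ^ (2 * n))" by simp
      also have "\<dots> \<le> (\<Sum>k. w k * (1 - l k) ^ (2 * n))"
        using u by (intro sum_le_suminf nn) (auto intro: sums_summable)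
      also have "\<dots> = u (2 * n)" using u by (simp add: sums_iff)
      finally show ?thesis by simp
    qed
    \<comment> \<open>There are m div 2 + 1 \<ge> (m + 1) / 2 even indices up to m.\<close>
    have "real (Suc m) / 2 * (w j / 2) \<le> real (card {..m div 2}) * (w j / 2)"
      by (intro mult_right_mono) (use w in auto)
    also have "\<dots> \<le> (\<Sum>n\<in>{..m div 2}. u (2 * n))"
      using up by (intro sum_bounded_below) auto
    also have "\<dots> = (\<Sum>n\<in>(\<lambda>n. 2 * n) ` {..m div 2}. u n)"
      by (subst sum.reindex) (auto simp: inj_on_def)
    also have "\<dots> \<le> (\<Sum>n\<le>m. u n)" by (intro sum_mono2 u0) auto
    finally have 1: "real (Suc m) * w j / 4 \<le> (\<Sum>n\<le>m. u n)" by simp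
    have "a / real (Suc m) \<le> l j" using lj a by (simp add: x_def field_simps)
    then have "\<theta> * (a / real (Suc m)) powr s \<le> \<theta> * l j powr s"
      using a \<theta> s by (intro mult_left_mono powr_mono2) auto
    also have "\<dots> \<le> w j" by (rule \<theta>)
    finally have "real (Suc m) * (\<theta> * (a / real (Suc m)) powr s) / 4 \<le> real (Suc m) * w j / 4"
      by (intro divide_right_mono mult_left_mono) auto
    also have "real (Suc m) * (\<theta> * (a / real (Suc m)) powr s) / 4 = \<theta> * a powr s / 4 * real (Suc m) powr (1 - s)"
      using a by (simp add: powr_divide powr_diff mult_ac)
    finally show ?thesis using 1 by linarith
  qed
  moreover have "\<theta> * a powr s / 4 > 0" using a \<theta> by simp
  ultimately show ?thesis by blast
qed

section \<open>Balls of the hierarchical group\<close>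

text \<open>These balls are nested finite subgroups. The condition i > k never reads coordinate 0,
  where elements of the carrier are \<open>undefined\<close>.\<close>

definition hier_ball :: "nat \<Rightarrow> nat \<Rightarrow> (nat \<Rightarrow> int) set" where
  "hier_ball N k = {x \<in> carrier (hier_group N). \<forall>i>k. x i = 0}"

lemma group_hier_group: "N \<ge> 1 \<Longrightarrow> group (hier_group N)"
  by (simp add: hier_group_def)

lemma mult_hier_group: "x \<otimes>\<^bsub>hier_group N\<^esub> y = (\<lambda>i\<in>{1..}. (x i + y i) mod int N)"
  by (simp add: hier_group_def mult_sum_group integer_mod_group_def)

lemma one_hier_group: "\<one>\<^bsub>hier_group N\<^esub> = (\<lambda>i\<in>{1..}. 0)"
  by (simp add: hier_group_def one_sum_group)

lemma hier_coord:
  assumes "N \<ge> 1" "x \<in> carrier (hier_group N)" "i \<ge> 1"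
  shows "0 \<le> x i" "x i < int N"
  using assms by (auto simp: carrier_hier_group PiE_def Pi_def)

lemma hier_group_ext:
  assumes "N \<ge> 1" "x \<in> carrier (hier_group N)" "y \<in> carrier (hier_group N)"
    and "\<And>i. i \<ge> 1 \<Longrightarrow> x i = y i"
  shows "x = y"
  using assms by (intro PiE_ext[of x "{1..}" "\<lambda>_. {0..<int N}" y]) (auto simp: carrier_hier_group)

lemma hier_abs_le_iff:
  assumes "N \<ge> 1" "x \<in> carrier (hier_group N)"
  shows "hier_abs x \<le> k \<longleftrightarrow> x \<in> hier_ball N k"
proof (cases "\<forall>i\<ge>1. x i = 0")
  case True
  then show ?thesis using assms by (auto simp: hier_abs_def hier_ball_def)
next
  case False
  have "finite {i. i \<ge> 1 \<and> x i \<noteq> 0}"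
    using assms by (auto simp: carrier_hier_group)
  then have "hier_abs x \<le> k \<longleftrightarrow> (\<forall>i\<in>{i. i \<ge> 1 \<and> x i \<noteq> 0}. i \<le> k)"
    using False unfolding hier_abs_def by (subst if_not_P) (auto simp: Max_le_iff)
  also have "\<dots> \<longleftrightarrow> x \<in> hier_ball N k"
    using assms(2) unfolding hier_ball_def
    by (smt (verit, best) One_nat_def Suc_leI bot_nat_0.not_eq_extremum linorder_not_le mem_Collect_eq not_less0)
  finally show ?thesis .
qed

lemma one_in_hier_ball: "N \<ge> 1 \<Longrightarrow> \<one>\<^bsub>hier_group N\<^esub> \<in> hier_ball N k"
  using monoid.one_closed[OF group.is_monoid[OF group_hier_group]]
  by (simp add: hier_ball_def one_hier_group)

lemma hier_ball_mono: "j \<le> k \<Longrightarrow> hier_ball N j \<subseteq> hier_ball N k"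
  by (auto simp: hier_ball_def)

lemma hier_ball_0: "N \<ge> 1 \<Longrightarrow> hier_ball N 0 = {\<one>\<^bsub>hier_group N\<^esub>}"
  using one_in_hier_ball[of N 0] 
  by (auto simp: hier_ball_def one_hier_group intro!: hier_group_ext[of N])

text \<open>Restriction to the first k coordinates is a bijection onto the functions from
  \<open>{1..k}\<close> to residues; its inverse extends by 0.\<close>

lemma card_hier_ball:
  assumes "N \<ge> 1"
  shows "finite (hier_ball N k)" "card (hier_ball N k) = N ^ k"
proof -
  let ?P = "{1..k} \<rightarrow>\<^sub>E {0..<int N}"
  let ?f = "\<lambda>x. restrict x {1..k}" and ?g = "\<lambda>y. \<lambda>i\<in>{1..}. if i \<le> k then y i else 0"
  have "bij_betw ?f (hier_ball N k) ?P"
  proof (rule bij_betw_byWitness[where f' = ?g])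
    show "\<forall>x\<in>hier_ball N k. ?g (?f x) = x"
    proof
      fix x assume x: "x \<in> hier_ball N k"
      then have "x \<in> extensional {1..}" using assms by (auto simp: hier_ball_def carrier_hier_group PiE_def)
      then show "?g (?f x) = x" using x by (auto simp: hier_ball_def fun_eq_iff extensional_def)
    qed
    show "\<forall>y\<in>?P. ?f (?g y) = y"
      by (auto simp: fun_eq_iff PiE_def extensional_def)
    show "?f ` hier_ball N k \<subseteq> ?P"
      using assms by (auto simp: hier_ball_def carrier_hier_group PiE_def Pi_def)
    show "?g ` ?P \<subseteq> hier_ball N k"
    proof
      fix x assume "x \<in> ?g ` ?P"
      then obtain y where y: "y \<in> ?P" "x = ?g y" by auto
      have "{i \<in> {1..}. x i \<noteq> 0} \<subseteq> {1..k}" using y by auto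
      then have "finite {i \<in> {1..}. x i \<noteq> 0}" by (rule finite_subset) simp
      then show "x \<in> hier_ball N k" using y assms
        by (auto simp: hier_ball_def carrier_hier_group PiE_def Pi_def)
    qed
  qed
  moreover have "finite ?P" "card ?P = N ^ k" by (auto intro!: finite_PiE simp: card_PiE)
  ultimately show "finite (hier_ball N k)" "card (hier_ball N k) = N ^ k"
    by (auto simp: bij_betw_finite bij_betw_same_card)
qed

text \<open>Adding an element that vanishes beyond k leaves the coordinates beyond k unchanged,
  since they are already reduced mod N.\<close>

lemma hier_ball_mult_iff:
  assumes "N \<ge> 1" "x \<in> carrier (hier_group N)" "y \<in> hier_ball N k"
  shows "x \<otimes>\<^bsub>hier_group N\<^esub> y \<in> hier_ball N k \<longleftrightarrow> x \<in> hier_ball N k"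
    and "y \<otimes>\<^bsub>hier_group N\<^esub> x \<in> hier_ball N k \<longleftrightarrow> x \<in> hier_ball N k"
proof -
  interpret group "hier_group N" by (rule group_hier_group) fact
  have y: "y \<in> carrier (hier_group N)" using assms by (auto simp: hier_ball_def)
  have m: "x i mod int N = x i" if "i > k" for i
    using hier_coord[OF assms(1,2), of i] that by simp
  show "x \<otimes>\<^bsub>hier_group N\<^esub> y \<in> hier_ball N k \<longleftrightarrow> x \<in> hier_ball N k"
    using assms(2,3) m_closed[OF assms(2) y] m by (auto simp: hier_ball_def mult_hier_group)
  show "y \<otimes>\<^bsub>hier_group N\<^esub> x \<in> hier_ball N k \<longleftrightarrow> x \<in> hier_ball N k"
    using assms(2,3) m_closed[OF y assms(2)] m by (auto simp: hier_ball_def mult_hier_group)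
qed

text \<open>The ultrametric property, argued on balls. For j \<ge> k the product lies in the
  subgroup \<open>hier_ball N j\<close>, so x lies there exactly when y does; for j < k neither
  does, because neither lies in \<open>hier_ball N k\<close>.\<close>

lemma hier_abs_eq_of_mult_in_ball:
  assumes "N \<ge> 1" "x \<in> carrier (hier_group N)" "y \<in> carrier (hier_group N)"
    and "x \<otimes>\<^bsub>hier_group N\<^esub> y \<in> hier_ball N k" and "x \<notin> hier_ball N k"
  shows "hier_abs y = hier_abs x"
proof -
  have "k < hier_abs x" using hier_abs_le_iff[OF assms(1,2)] assms(5) by (metis not_le)
  have sub: "hier_ball N k \<subseteq> hier_ball N j" if "k \<le> j" for j using that by (rule hier_ball_mono)
  have yk: "y \<notin> hier_ball N k" 
    using hier_ball_mult_iff(1)[OF assms(1,2)] assms(4,5) by blast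
  have "y \<in> hier_ball N j \<longleftrightarrow> x \<in> hier_ball N j" for j
  proof (cases "j \<ge> k")
    case True
    then have "x \<otimes>\<^bsub>hier_group N\<^esub> y \<in> hier_ball N j" using sub assms(4) by blast
    then show ?thesis using hier_ball_mult_iff[OF assms(1)] assms(2,3) by blast
  next
    case False
    then show ?thesis using hier_ball_mono[of j k N] yk assms(5) by auto
  qed
  then have "hier_abs y \<le> j \<longleftrightarrow> hier_abs x \<le> j" for j
    using hier_abs_le_iff[OF assms(1)] assms(2,3) by blast
  then show ?thesis by (metis dual_order.antisym order_refl)
qed

lemma card_translates_in_hier_ball:
  assumes "N \<ge> 1" "x \<in> carrier (hier_group N)"
  shows "finite {y \<in> carrier (hier_group N). x \<otimes>\<^bsub>hier_group N\<^esub> y \<in> hier_ball N k}"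
    and "card {y \<in> carrier (hier_group N). x \<otimes>\<^bsub>hier_group N\<^esub> y \<in> hier_ball N k} = N ^ k"
proof -
  interpret group "hier_group N" by (rule group_hier_group) fact
  let ?A = "{y \<in> carrier (hier_group N). x \<otimes>\<^bsub>hier_group N\<^esub> y \<in> hier_ball N k}"
  have sub: "hier_ball N k \<subseteq> carrier (hier_group N)" by (auto simp: hier_ball_def)
  have "bij_betw (\<lambda>y. x \<otimes>\<^bsub>hier_group N\<^esub> y) ?A (hier_ball N k)"
    using assms sub
    by (intro bij_betw_byWitness[where f' = "\<lambda>y. inv\<^bsub>hier_group N\<^esub> x \<otimes>\<^bsub>hier_group N\<^esub> y"])
       (auto simp: m_assoc[symmetric] subset_iff)
  then show "finite ?A" "card ?A = N ^ k"
    using card_hier_ball[OF assms(1), of k] by (auto simp: bij_betw_finite bij_betw_same_card)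
qed

lemma countable_hier_group: "N \<ge> 1 \<Longrightarrow> countable (carrier (hier_group N))"
proof -
  assume N: "N \<ge> 1"
  have "carrier (hier_group N) \<subseteq> (\<Union>k. hier_ball N k)"
    using hier_abs_le_iff[OF N] by blast
  moreover have "countable (\<Union>k. hier_ball N k)"
    using card_hier_ball[OF N] by (intro countable_UN) (auto intro: countable_finite)
  ultimately show ?thesis by (rule countable_subset)
qed

lemma hier_sphere:
  assumes "N \<ge> 1"
  shows "{x \<in> carrier (hier_group N). hier_abs x = Suc k} = hier_ball N (Suc k) - hier_ball N k"
proof -
  have "hier_abs x = Suc k \<longleftrightarrow> x \<in> hier_ball N (Suc k) - hier_ball N k"
    if "x \<in> carrier (hier_group N)" for x
    unfolding Diff_iff hier_abs_le_iff[OF assms that, symmetric] by auto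
  moreover have "hier_ball N (Suc k) \<subseteq> carrier (hier_group N)" by (auto simp: hier_ball_def)
  ultimately show ?thesis by blast
qed

section \<open>Independence of holding times and steps\<close>

lemma UN_Times_singleton: "(\<Union>i\<in>A \<times> {b}. f i) = (\<Union>k\<in>A. f (k, b))"
  by auto

text \<open>The sub-sigma-algebras are passed as measures \<open>A\<close> and \<open>B\<close> so
  that \<open>measurable\<close> can refer to them; each variable generates a sigma-algebra inside
  its own one.\<close>

lemma (in prob_space) indep_var_of_indep_set:
  assumes "indep_set (sets A) (sets B)" and "space A = space M" "space B = space M"
    and X: "X \<in> measurable A S" and Y: "Y \<in> measurable B T"
  shows "indep_var S X T Y"
proof -
  have AB: "sets A \<subseteq> events" "sets B \<subseteq> events"
    using assms(1) by (auto simp: indep_sets2_eq)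
  have "random_variable S X" "random_variable T Y"
    using measurable_mono[of S S A M] measurable_mono[of T T B M] AB assms by auto
  moreover have "indep_set (sigma_sets (space M) {X -` C \<inter> space M | C. C \<in> sets S})
      (sigma_sets (space M) {Y -` C \<inter> space M | C. C \<in> sets T})"
  proof -
    have 1: "sigma_sets (space M) {X -` C \<inter> space M | C. C \<in> sets S} \<subseteq> sets A"
      using measurable_sets[OF X] assms(2) 
      by (subst sets.sigma_sets_eq[symmetric], subst assms(2), intro sigma_sets_mono') auto
    have 2: "sigma_sets (space M) {Y -` C \<inter> space M | C. C \<in> sets T} \<subseteq> sets B"
      using measurable_sets[OF Y] assms(3)
      by (subst sets.sigma_sets_eq[symmetric], subst assms(3), intro sigma_sets_mono') auto
    from 1 2 show ?thesis using assms(1) unfolding indep_sets2_eq by blast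
  qed
  ultimately show ?thesis by (simp add: indep_var_eq)
qed

section \<open>Sigma-algebras generated by holding times and by steps\<close>

locale hier_walk = hierarchical_walk M N r hold step
  for M :: "'w measure" and N :: nat and r :: "nat \<Rightarrow> real"
    and hold :: "nat \<Rightarrow> 'w \<Rightarrow> real" and step :: "nat \<Rightarrow> 'w \<Rightarrow> nat \<Rightarrow> int" +
  assumes N2: "N \<ge> 2"
begin

abbreviation "\<Omega> \<equiv> carrier (hier_group N)"

lemma N1: "N \<ge> 1" using N2 by simp

sublocale G: group "hier_group N" by (rule group_hier_group) (rule N1)

lemma step_in: "\<omega> \<in> space M \<Longrightarrow> step k \<omega> \<in> \<Omega>"
  using measurable_space[OF step_measurable] by simp

lemma hold_borel: "hold k \<in> borel_measurable M"
  using distributed_measurable[OF hold_distributed] by simp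

definition hold_events :: "nat \<Rightarrow> 'w set set" where
  "hold_events k = {hold k -` A \<inter> space M | A. A \<in> sets borel}"

definition step_events :: "nat \<Rightarrow> 'w set set" where
  "step_events k = {step k -` B \<inter> space M | B. B \<subseteq> \<Omega>}"

lemma Int_stable_hold_events: "Int_stable (hold_events k)"
proof (rule Int_stableI)
  fix A B assume "A \<in> hold_events k" "B \<in> hold_events k"
  then obtain A' B' where AB: "A = hold k -` A' \<inter> space M" "A' \<in> sets borel"
    "B = hold k -` B' \<inter> space M" "B' \<in> sets borel" by (auto simp: hold_events_def)
  then have "A \<inter> B = hold k -` (A' \<inter> B') \<inter> space M" "A' \<inter> B' \<in> sets borel" by auto
  then show "A \<inter> B \<in> hold_events k" unfolding hold_events_def by blast
qed

lemma Int_stable_step_events: "Int_stable (step_events k)"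
proof (rule Int_stableI)
  fix A B assume "A \<in> step_events k" "B \<in> step_events k"
  then obtain A' B' where AB: "A = step k -` A' \<inter> space M" "A' \<subseteq> \<Omega>"
    "B = step k -` B' \<inter> space M" "B' \<subseteq> \<Omega>" by (auto simp: step_events_def)
  then have "A \<inter> B = step k -` (A' \<inter> B') \<inter> space M" "A' \<inter> B' \<subseteq> \<Omega>" by auto
  then show "A \<inter> B \<in> step_events k" unfolding step_events_def by blast
qed

lemma space_in_events: "space M \<in> hold_events k" "space M \<in> step_events k"
proof -
  show "space M \<in> hold_events k" unfolding hold_events_def by (intro CollectI exI[of _ UNIV]) auto
  show "space M \<in> step_events k" unfolding step_events_def 
    using step_in by (intro CollectI exI[of _ \<Omega>]) auto
qed

lemma pair_event:
  assumes "A \<in> hold_events k" "B \<in> step_events k"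
  shows "\<exists>C\<in>sets (borel \<Otimes>\<^sub>M count_space \<Omega>). A \<inter> B = (\<lambda>\<omega>. (hold k \<omega>, step k \<omega>)) -` C \<inter> space M"
proof -
  obtain A' B' where "A = hold k -` A' \<inter> space M" "A' \<in> sets borel"
    "B = step k -` B' \<inter> space M" "B' \<subseteq> \<Omega>"
    using assms by (auto simp: hold_events_def step_events_def)
  then show ?thesis by (intro bexI[of _ "A' \<times> B'"]) auto
qed

lemma indep_set_events: "indep_set (hold_events k) (step_events k)"
  using hold_step_indep unfolding hold_events_def step_events_def by simp

text \<open>All holding times and all steps form one independent family, indexed by
  \<open>(k, True)\<close> for the k-th holding time and \<open>(k, False)\<close> for the k-th
  step. Independence of the pairs factorises over k, and independence within a pair splits each
  factor.\<close>

lemma indep_hold_step_events: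
  "indep_sets (\<lambda>(k, b). if b then hold_events k else step_events k) UNIV"
proof (rule indep_setsI)
  fix i :: "nat \<times> bool"
  show "(case i of (k, b) \<Rightarrow> if b then hold_events k else step_events k) \<subseteq> events"
    using measurable_sets[OF hold_borel] measurable_sets[OF step_measurable]
    by (auto simp: hold_events_def step_events_def split: prod.splits)
next
  fix A :: "nat \<times> bool \<Rightarrow> 'w set" and J :: "(nat \<times> bool) set"
  assume J: "J \<noteq> {}" "finite J"
    and A: "\<forall>j\<in>J. A j \<in> (case j of (k, b) \<Rightarrow> if b then hold_events k else step_events k)"
  define K where "K = fst ` J"
  \<comment> \<open>Entries missing from J are filled with the whole space, so that every k in K
    contributes a complete pair.\<close>
  define A' where "A' j = (if j \<in> J then A j else space M)" for j
  have K: "finite K" "K \<noteq> {}" using J by (auto simp: K_def)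
  have A': "A' (k, True) \<in> hold_events k" "A' (k, False) \<in> step_events k" for k
    using A space_in_events by (auto simp: A'_def)
  obtain C where C: "\<And>k. C k \<in> sets (borel \<Otimes>\<^sub>M count_space \<Omega>)"
    "\<And>k. A' (k, True) \<inter> A' (k, False) = (\<lambda>\<omega>. (hold k \<omega>, step k \<omega>)) -` C k \<inter> space M"
    using pair_event[OF A'] by metis
  have sp: "A j \<subseteq> space M" if "j \<in> J" for j
  proof -
    have "A j \<in> hold_events (fst j) \<union> step_events (fst j)"
      using A that by (cases j; cases "snd j") fastforce+
    then show ?thesis by (auto simp: hold_events_def step_events_def)
  qed
  have "(\<Inter>j\<in>J. A j) = (\<Inter>k\<in>K. A' (k, True) \<inter> A' (k, False))"
  proof (intro equalityI subsetI)
    fix x assume x: "x \<in> (\<Inter>j\<in>J. A j)"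
    then have "x \<in> space M" using J sp by blast
    then show "x \<in> (\<Inter>k\<in>K. A' (k, True) \<inter> A' (k, False))" using x by (auto simp: A'_def)
  next
    fix x assume x: "x \<in> (\<Inter>k\<in>K. A' (k, True) \<inter> A' (k, False))"
    have "x \<in> A (k, b)" if "(k, b) \<in> J" for k b
    proof -
      have "k \<in> K" using that by (force simp: K_def)
      then have "x \<in> A' (k, b)" using x by (cases b) auto
      then show ?thesis using that by (simp add: A'_def)
    qed
    then show "x \<in> (\<Inter>j\<in>J. A j)" by auto
  qed
  also have "\<dots> = (\<Inter>k\<in>K. (\<lambda>\<omega>. (hold k \<omega>, step k \<omega>)) -` C k \<inter> space M)" using C(2) by simp
  finally have "prob (\<Inter>j\<in>J. A j) = (\<Prod>k\<in>K. prob ((\<lambda>\<omega>. (hold k \<omega>, step k \<omega>)) -` C k \<inter> space M))"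
    using indep_varsD[OF pairs_indep K(2,1)] C(1) by simp
  also have "\<dots> = (\<Prod>k\<in>K. prob (A' (k, True)) * prob (A' (k, False)))"
    unfolding C(2)[symmetric]
    by (intro prod.cong refl indep_setD[OF indep_set_events A'])
  also have "\<dots> = (\<Prod>k\<in>K. \<Prod>b\<in>UNIV. prob (A' (k, b)))" by (simp add: UNIV_bool mult.commute)
  also have "\<dots> = (\<Prod>j\<in>K \<times> UNIV. prob (A' j))" by (simp add: prod.cartesian_product)
  \<comment> \<open>The filled-in entries have probability 1 and drop out of the product.\<close>
  also have "\<dots> = (\<Prod>j\<in>J. prob (A j))"
  proof (rule prod.mono_neutral_cong_right)
    show "J \<subseteq> K \<times> UNIV" by (auto simp: K_def image_iff) (metis fst_conv)
    show "finite (K \<times> (UNIV :: bool set))" using K by simp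
  qed (auto simp: A'_def prob_space)
  finally show "prob (\<Inter>j\<in>J. A j) = (\<Prod>j\<in>J. prob (A j))" .
qed

text \<open>A measure serving only as a carrier of a sigma-algebra on \<open>space M\<close>;
  probabilities are always taken in \<open>M\<close>.\<close>

definition hold_algebra :: "'w measure" where
  "hold_algebra = sigma (space M) (\<Union>k. hold_events k)"

definition step_algebra :: "nat set \<Rightarrow> 'w measure" where
  "step_algebra J = sigma (space M) (\<Union>k\<in>J. step_events k)"

lemma space_algebras [simp]: "space hold_algebra = space M" "space (step_algebra J) = space M"
  unfolding hold_algebra_def step_algebra_def
  by (auto intro!: space_measure_of simp: hold_events_def step_events_def)

lemma sets_algebras:
  "sets hold_algebra = sigma_sets (space M) (\<Union>k. hold_events k)"
  "sets (step_algebra J) = sigma_sets (space M) (\<Union>k\<in>J. step_events k)"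
  unfolding hold_algebra_def step_algebra_def
  by (auto intro!: sets_measure_of simp: hold_events_def step_events_def)

text \<open>Disjoint groups of independent intersection-stable families generate independent
  sigma-algebras. It yields both the independence of holding times from steps and that of past steps
  from future ones.\<close>

lemma indep_set_sigma_events:
  assumes "I \<inter> J = {}"
  shows "indep_set
    (sigma_sets (space M) (\<Union>i\<in>I. (\<lambda>(k, b). if b then hold_events k else step_events k) i))
    (sigma_sets (space M) (\<Union>i\<in>J. (\<lambda>(k, b). if b then hold_events k else step_events k) i))"
    (is "indep_set (?S I) (?S J)")
proof -
  have "indep_sets (\<lambda>b. ?S (if b then I else J)) (UNIV :: bool set)"
  proof (rule indep_sets_collect_sigma)
    show "indep_sets (\<lambda>(k, b). if b then hold_events k else step_events k) (\<Union>b. if b then I else J)"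
      by (rule indep_sets_mono_index[OF _ indep_hold_step_events]) simp
    show "Int_stable ((\<lambda>(k, b). if b then hold_events k else step_events k) i)" for i
      using Int_stable_hold_events Int_stable_step_events by (cases i) auto
    show "disjoint_family_on (\<lambda>b. if b then I else J) UNIV"
      using assms by (auto simp: disjoint_family_on_def)
  qed
  moreover have "(\<lambda>b. ?S (if b then I else J)) = case_bool (?S I) (?S J)"
    by (rule ext) (simp split: bool.split)
  ultimately show ?thesis unfolding indep_set_def by simp
qed

lemma indep_hold_step_algebra: "indep_set (sets hold_algebra) (sets (step_algebra UNIV))"
proof -
  have "UNIV \<times> {True} \<inter> UNIV \<times> {False} = ({} :: (nat \<times> bool) set)" by blast
  from indep_set_sigma_events[OF this] show ?thesis
    unfolding sets_algebras UN_Times_singleton prod.case if_True if_False .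
qed

lemma indep_step_algebra:
  assumes "J \<inter> K = {}"
  shows "indep_set (sets (step_algebra J)) (sets (step_algebra K))"
proof -
  have "J \<times> {False} \<inter> K \<times> {False} = {}" using assms by blast
  from indep_set_sigma_events[OF this] show ?thesis
    unfolding sets_algebras UN_Times_singleton prod.case if_True if_False .
qed

lemma hold_measurable_algebra: "hold k \<in> borel_measurable hold_algebra"
  by (rule measurableI) (auto simp: sets_algebras hold_events_def intro!: sigma_sets.Basic)

lemma step_measurable_algebra: "k \<in> J \<Longrightarrow> step k \<in> measurable (step_algebra J) (count_space \<Omega>)"
  using step_in by (intro measurableI) (auto simp: sets_algebras step_events_def intro!: sigma_sets.Basic)

lemma sets_algebras_subset: "sets hold_algebra \<subseteq> events" "sets (step_algebra J) \<subseteq> events"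
proof -
  show "sets hold_algebra \<subseteq> events" using indep_hold_step_algebra by (auto simp: indep_sets2_eq)
  show "sets (step_algebra J) \<subseteq> events" using indep_step_algebra[of J "{}"] by (auto simp: indep_sets2_eq)
qed

section \<open>Measurability of the jump chain\<close>

lemma countable_\<Omega>: "countable \<Omega>" by (rule countable_hier_group) (rule N1)

lemma mult_measurable:
  assumes "X \<in> measurable K (count_space \<Omega>)" "Y \<in> measurable K (count_space \<Omega>)"
  shows "(\<lambda>\<omega>. X \<omega> \<otimes>\<^bsub>hier_group N\<^esub> Y \<omega>) \<in> measurable K (count_space \<Omega>)"
proof (rule measurable_compose_countable'[OF _ assms(1) countable_\<Omega>])
  fix z assume "z \<in> \<Omega>"
  then show "(\<lambda>\<omega>. z \<otimes>\<^bsub>hier_group N\<^esub> Y \<omega>) \<in> measurable K (count_space \<Omega>)"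
    by (intro measurable_compose[OF assms(2)]) auto
qed

text \<open>The step sequence and the source sigma-algebra are kept general, so that the lemma also
  serves the sub-sigma-algebras, the shifted steps and the coordinate process on the sequence
  space.\<close>

lemma jump_chain_measurable:
  assumes "\<And>k. k < n \<Longrightarrow> s k \<in> measurable K (count_space \<Omega>)" "x \<in> \<Omega>"
  shows "jump_chain N s x n \<in> measurable K (count_space \<Omega>)"
  using assms
proof (induction n)
  case 0
  have "jump_chain N s x 0 = (\<lambda>_. x)" by auto
  then show ?case using 0 by simp
next
  case (Suc n)
  have "jump_chain N s x (Suc n) = (\<lambda>\<omega>. jump_chain N s x n \<omega> \<otimes>\<^bsub>hier_group N\<^esub> s n \<omega>)" by auto
  then show ?case using Suc by (auto intro!: mult_measurable)
qed

lemmas jump_chain_meas = jump_chain_measurable[OF step_measurable]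

lemma jump_chain_in: "x \<in> \<Omega> \<Longrightarrow> \<omega> \<in> space M \<Longrightarrow> jump_chain N step x n \<omega> \<in> \<Omega>"
  using measurable_space[OF jump_chain_meas] by simp

end

section \<open>Eigenfunctions of the jump chain\<close>

text \<open>Divided by b ^ (k + 1), the relation becomes the telescoping difference of F k / b ^ k,
  whose limit is 0 because F is bounded. With F k the probability of a ball of radius k, the sum
  recovers the probability of the origin.\<close>

lemma sums_geometric_telescope:
  fixes F a :: "nat \<Rightarrow> real"
  assumes "b > 1" and "\<And>k. 0 \<le> F k" "\<And>k. F k \<le> 1" and "\<And>k. b * F k - F (Suc k) = a k"
  shows "(\<lambda>k. a k / b ^ Suc k) sums F 0"
proof -
  have "a k / b ^ Suc k = F k / b ^ k - F (Suc k) / b ^ Suc k" for k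
    unfolding assms(4)[symmetric] using assms(1) by (simp add: field_simps)
  moreover have "(\<lambda>k. F k / b ^ k - F (Suc k) / b ^ Suc k) sums (F 0 / b ^ 0 - 0)"
  proof (rule telescope_sums')
    have "(\<lambda>k. (1 / b) ^ k) \<longlonglongrightarrow> 0" using assms(1) by (intro LIMSEQ_power_zero) auto
    then show "(\<lambda>k. F k / b ^ k) \<longlonglongrightarrow> 0"
      by (rule tendsto_sandwich[OF _ _ tendsto_const, rotated -1])
         (use assms in \<open>auto simp: power_divide divide_right_mono\<close>)
  qed
  ultimately show ?thesis by simp
qed

context hier_walk begin

section \<open>Ball probabilities after one step\<close>

lemma prob_step_finite:
  assumes "A \<subseteq> \<Omega>" "finite A"
  shows "prob {\<omega> \<in> space M. step n \<omega> \<in> A} = (\<Sum>y\<in>A. step_prob N r y)"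
proof -
  have "{\<omega> \<in> space M. step n \<omega> \<in> A} = (\<Union>y\<in>A. {\<omega> \<in> space M. step n \<omega> = y})" by auto
  also have "prob \<dots> = (\<Sum>y\<in>A. prob {\<omega> \<in> space M. step n \<omega> = y})"
  proof (rule finite_measure_finite_Union[OF assms(2)])
    show "(\<lambda>y. {\<omega> \<in> space M. step n \<omega> = y}) ` A \<subseteq> events"
    proof
      fix E assume "E \<in> (\<lambda>y. {\<omega> \<in> space M. step n \<omega> = y}) ` A"
      then obtain y where y: "y \<in> A" "E = {\<omega> \<in> space M. step n \<omega> = y}" by auto
      then have "E = step n -` {y} \<inter> space M" by auto
      then show "E \<in> events" using measurable_sets[OF step_measurable, of "{y}" n] y assms(1) by auto
    qed
  qed (auto simp: disjoint_family_on_def)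
  also have "\<dots> = (\<Sum>y\<in>A. step_prob N r y)"
    using assms(1) by (intro sum.cong step_distribution) auto
  finally show ?thesis .
qed

lemma hier_ball_subset: "hier_ball N k \<subseteq> \<Omega>" by (auto simp: hier_ball_def)

text \<open>The sphere of radius k + 1 has N ^ k * (N - 1) elements, which cancels the normalisation
  in \<open>step_prob\<close> and leaves mass \<open>r (Suc k)\<close>.\<close>

lemma sum_step_prob_hier_ball: "(\<Sum>y\<in>hier_ball N k. step_prob N r y) = (\<Sum>j<k. r (Suc j))"
proof (induction k)
  case 0
  then show ?case using N1 by (simp add: hier_ball_0 step_prob_def)
next
  case (Suc k)
  have fin: "finite (hier_ball N j)" and card: "card (hier_ball N j) = N ^ j" for j
    using card_hier_ball[OF N1] by auto
  have sub: "hier_ball N k \<subseteq> hier_ball N (Suc k)" by (rule hier_ball_mono) simp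
  have "(\<Sum>y\<in>hier_ball N (Suc k). step_prob N r y) =
      (\<Sum>y\<in>hier_ball N (Suc k) - hier_ball N k. step_prob N r y) + (\<Sum>y\<in>hier_ball N k. step_prob N r y)"
    by (rule sum.subset_diff[OF sub fin])
  also have "(\<Sum>y\<in>hier_ball N (Suc k) - hier_ball N k. step_prob N r y) =
      (\<Sum>y\<in>hier_ball N (Suc k) - hier_ball N k. r (Suc k) / (real N ^ k * (real N - 1)))"
  proof (rule sum.cong[OF refl])
    fix y assume "y \<in> hier_ball N (Suc k) - hier_ball N k"
    then have "hier_abs y = Suc k" "y \<noteq> \<one>\<^bsub>hier_group N\<^esub>"
      using hier_sphere[OF N1, of k] one_in_hier_ball[OF N1] by auto
    then show "step_prob N r y = r (Suc k) / (real N ^ k * (real N - 1))"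
      by (simp add: step_prob_def)
  qed
  also have "\<dots> = real (N ^ Suc k - N ^ k) * (r (Suc k) / (real N ^ k * (real N - 1)))"
    using card_Diff_subset[OF fin sub] by (simp add: card)
  also have "real (N ^ Suc k - N ^ k) = real N ^ k * (real N - 1)"
    using N1 by (subst of_nat_diff) (auto simp: algebra_simps)
  also have "real N ^ k * (real N - 1) * (r (Suc k) / (real N ^ k * (real N - 1))) = r (Suc k)"
    using N2 by simp
  finally show ?case using Suc by simp
qed

text \<open>From inside the ball the step itself must lie in the ball. From outside, each of the N ^
  k admissible steps has the same norm as z and hence the same probability.\<close>

lemma prob_translate_in_hier_ball:
  assumes "z \<in> \<Omega>"
  shows "prob {\<omega> \<in> space M. z \<otimes>\<^bsub>hier_group N\<^esub> step n \<omega> \<in> hier_ball N k} =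
    (if z \<in> hier_ball N k then \<Sum>j<k. r (Suc j)
     else real N ^ k * (r (hier_abs z) / (real N ^ (hier_abs z - 1) * (real N - 1))))"
proof -
  let ?A = "{y \<in> \<Omega>. z \<otimes>\<^bsub>hier_group N\<^esub> y \<in> hier_ball N k}"
  have "{\<omega> \<in> space M. z \<otimes>\<^bsub>hier_group N\<^esub> step n \<omega> \<in> hier_ball N k} = {\<omega> \<in> space M. step n \<omega> \<in> ?A}"
    using step_in by auto
  then have *: "prob {\<omega> \<in> space M. z \<otimes>\<^bsub>hier_group N\<^esub> step n \<omega> \<in> hier_ball N k} = (\<Sum>y\<in>?A. step_prob N r y)"
    using card_translates_in_hier_ball(1)[OF N1 assms] by (simp only:) (rule prob_step_finite, auto)
  show ?thesis
  proof (cases "z \<in> hier_ball N k")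
    case True
    then have "?A = hier_ball N k" using hier_ball_mult_iff(2)[OF N1 _ True] hier_ball_subset by auto
    then show ?thesis using * True by (simp add: sum_step_prob_hier_ball)
  next
    case False
    have "(\<Sum>y\<in>?A. step_prob N r y) =
      (\<Sum>y\<in>?A. r (hier_abs z) / (real N ^ (hier_abs z - 1) * (real N - 1)))"
    proof (rule sum.cong[OF refl])
      fix y assume y: "y \<in> ?A"
      have "hier_abs y = hier_abs z"
        using y False by (intro hier_abs_eq_of_mult_in_ball[OF N1 assms]) auto
      moreover have "y \<noteq> \<one>\<^bsub>hier_group N\<^esub>" using y False assms by auto
      ultimately show "step_prob N r y = r (hier_abs z) / (real N ^ (hier_abs z - 1) * (real N - 1))"
        by (simp add: step_prob_def)
    qed
    then show ?thesis using * False card_translates_in_hier_ball(2)[OF N1 assms, of k] by simp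
  qed
qed

text \<open>The Fourier transform of the step law at a character that is trivial on the ball of
  radius k but not on the ball of radius k + 1.\<close>

definition eigval :: "nat \<Rightarrow> real" where
  "eigval k = (\<Sum>j<k. r (Suc j)) - r (Suc k) / (real N - 1)"

text \<open>Up to the factor N ^ (k + 1), the difference of the uniform densities on two consecutive
  balls.\<close>

definition eigfun :: "nat \<Rightarrow> (nat \<Rightarrow> int) \<Rightarrow> real" where
  "eigfun k z = real N * indicator (hier_ball N k) z - indicator (hier_ball N (Suc k)) z"

lemma abs_eigfun_le: "\<bar>eigfun k z\<bar> \<le> real N"
proof -
  have "hier_ball N k \<subseteq> hier_ball N (Suc k)" by (rule hier_ball_mono) simp
  then show ?thesis using N2 by (auto simp: eigfun_def indicator_def)
qed

text \<open>The bound is the value at the origin; this maximality makes the return probability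
  dominate every transition probability at the same time.\<close>

lemma eigfun_le: "eigfun k z \<le> real N - 1"
proof -
  have "hier_ball N k \<subseteq> hier_ball N (Suc k)" by (rule hier_ball_mono) simp
  then show ?thesis using N2 by (auto simp: eigfun_def indicator_def)
qed

lemma eigfun_one: "eigfun k \<one>\<^bsub>hier_group N\<^esub> = real N - 1"
  using one_in_hier_ball[OF N1] by (simp add: eigfun_def)

lemma expectation_indicator_hier_ball:
  assumes "X \<in> measurable M (count_space \<Omega>)"
  shows "expectation (\<lambda>\<omega>. indicat_real (hier_ball N k) (X \<omega>)) = prob {\<omega> \<in> space M. X \<omega> \<in> hier_ball N k}"
    and "integrable M (\<lambda>\<omega>. indicator (hier_ball N k) (X \<omega>) :: real)"
proof -
  have "X -` hier_ball N k \<inter> space M \<in> events"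
    using measurable_sets[OF assms] hier_ball_subset by auto
  moreover have "X -` hier_ball N k \<inter> space M = {\<omega> \<in> space M. X \<omega> \<in> hier_ball N k}" by auto
  ultimately have ev: "{\<omega> \<in> space M. X \<omega> \<in> hier_ball N k} \<in> events" by simp
  have "expectation (\<lambda>\<omega>. indicat_real (hier_ball N k) (X \<omega>)) =
      expectation (indicat_real {\<omega> \<in> space M. X \<omega> \<in> hier_ball N k})"
    by (intro Bochner_Integration.integral_cong) (auto simp: indicator_def)
  then show "expectation (\<lambda>\<omega>. indicat_real (hier_ball N k) (X \<omega>)) = prob {\<omega> \<in> space M. X \<omega> \<in> hier_ball N k}"
    using ev by simp
  have "integrable M (indicat_real {\<omega> \<in> space M. X \<omega> \<in> hier_ball N k})"
    using ev by (rule integrable_real_indicator) (simp add: emeasure_eq_measure)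
  then show "integrable M (\<lambda>\<omega>. indicator (hier_ball N k) (X \<omega>) :: real)"
    by (rule Bochner_Integration.integrable_cong[THEN iffD1, rotated -1]) (auto simp: indicator_def)
qed

lemma expectation_eigfun:
  assumes "X \<in> measurable M (count_space \<Omega>)"
  shows "expectation (\<lambda>\<omega>. eigfun k (X \<omega>)) =
    real N * prob {\<omega> \<in> space M. X \<omega> \<in> hier_ball N k} - prob {\<omega> \<in> space M. X \<omega> \<in> hier_ball N (Suc k)}"
  unfolding eigfun_def
  using expectation_indicator_hier_ball[OF assms] by (subst Bochner_Integration.integral_diff) auto

text \<open>Three positions of z are compared: in the smaller ball, on the sphere between the balls,
  and outside the larger ball, where the two contributions cancel since N * N ^ k = N ^ (k +
  1).\<close>

lemma expectation_eigfun_step: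
  assumes "z \<in> \<Omega>"
  shows "expectation (\<lambda>\<omega>. eigfun k (z \<otimes>\<^bsub>hier_group N\<^esub> step n \<omega>)) = eigval k * eigfun k z"
proof -
  have meas: "(\<lambda>\<omega>. z \<otimes>\<^bsub>hier_group N\<^esub> step n \<omega>) \<in> measurable M (count_space \<Omega>)"
    using assms by (intro mult_measurable step_measurable) simp
  have sub: "hier_ball N k \<subseteq> hier_ball N (Suc k)" by (rule hier_ball_mono) simp
  have abs: "hier_abs z = Suc k" if "z \<in> hier_ball N (Suc k)" "z \<notin> hier_ball N k"
    using hier_sphere[OF N1, of k] that assms by auto
  show ?thesis
    unfolding expectation_eigfun[OF meas] prob_translate_in_hier_ball[OF assms]
  proof (cases "z \<in> hier_ball N (Suc k)")
    case False
    then have "z \<notin> hier_ball N k" using sub by blast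
    with False show "real N * (if z \<in> hier_ball N k then \<Sum>j<k. r (Suc j)
        else real N ^ k * (r (hier_abs z) / (real N ^ (hier_abs z - 1) * (real N - 1)))) -
      (if z \<in> hier_ball N (Suc k) then \<Sum>j<Suc k. r (Suc j)
        else real N ^ Suc k * (r (hier_abs z) / (real N ^ (hier_abs z - 1) * (real N - 1)))) =
      eigval k * eigfun k z" by (simp add: eigfun_def)
  qed (use N2 sub abs in \<open>auto simp: eigfun_def eigval_def field_simps\<close>)
qed

text \<open>Conditioning on X: it depends only on steps before n, so its joint law with
  \<open>step n\<close> is a product and Fubini applies; boundedness of g gives
  integrability.\<close>

lemma expectation_mult_step:
  fixes g :: "(nat \<Rightarrow> int) \<Rightarrow> real"
  assumes X: "X \<in> measurable (step_algebra {..<n}) (count_space \<Omega>)" and g: "\<And>z. \<bar>g z\<bar> \<le> C"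
  shows "expectation (\<lambda>\<omega>. g (X \<omega> \<otimes>\<^bsub>hier_group N\<^esub> step n \<omega>)) =
    (\<integral>z. expectation (\<lambda>\<omega>. g (z \<otimes>\<^bsub>hier_group N\<^esub> step n \<omega>)) \<partial>distr M (count_space \<Omega>) X)"
proof -
  let ?S = "count_space \<Omega>" and ?g = "\<lambda>(z, y). g (z \<otimes>\<^bsub>hier_group N\<^esub> y)"
  have XM: "X \<in> measurable M ?S"
    using measurable_mono[of ?S ?S "step_algebra {..<n}" M] sets_algebras_subset X by auto
  have "indep_var ?S X ?S (step n)"
    by (rule indep_var_of_indep_set[OF indep_step_algebra[of "{..<n}" "{n}"]])
       (auto intro: X step_measurable_algebra)
  then have distr: "distr M ?S X \<Otimes>\<^sub>M distr M ?S (step n) = distr M (?S \<Otimes>\<^sub>M ?S) (\<lambda>\<omega>. (X \<omega>, step n \<omega>))"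
    unfolding indep_var_distribution_eq by simp
  interpret P: prob_space "distr M ?S X" by (rule prob_space_distr[OF XM])
  interpret Q: prob_space "distr M ?S (step n)" by (rule prob_space_distr[OF step_measurable])
  interpret PQ: pair_prob_space "distr M ?S X" "distr M ?S (step n)" ..
  have SS: "?S \<Otimes>\<^sub>M ?S = count_space (\<Omega> \<times> \<Omega>)"
    by (intro pair_measure_countable countable_\<Omega>)
  have meas: "?g \<in> borel_measurable (?S \<Otimes>\<^sub>M ?S)" unfolding SS by simp
  have int: "integrable (distr M ?S X \<Otimes>\<^sub>M distr M ?S (step n)) ?g"
    by (rule PQ.integrable_const_bound[of _ C]) (use g meas in \<open>auto simp: distr\<close>)
  have "expectation (\<lambda>\<omega>. g (X \<omega> \<otimes>\<^bsub>hier_group N\<^esub> step n \<omega>)) =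
    integral\<^sup>L (distr M (?S \<Otimes>\<^sub>M ?S) (\<lambda>\<omega>. (X \<omega>, step n \<omega>))) ?g"
    using XM step_measurable meas by (subst integral_distr) auto
  also have "\<dots> = (\<integral>z. (\<integral>y. ?g (z, y) \<partial>distr M ?S (step n)) \<partial>distr M ?S X)"
    unfolding distr[symmetric] by (rule PQ.integral_fst'[OF int, symmetric])
  also have "\<dots> = (\<integral>z. expectation (\<lambda>\<omega>. g (z \<otimes>\<^bsub>hier_group N\<^esub> step n \<omega>)) \<partial>distr M ?S X)"
    by (intro Bochner_Integration.integral_cong refl) (simp add: integral_distr[OF step_measurable])
  finally show ?thesis .
qed

lemma expectation_eigfun_jump_chain:
  assumes "x \<in> \<Omega>"
  shows "expectation (\<lambda>\<omega>. eigfun k (jump_chain N step x n \<omega>)) = eigval k ^ n * eigfun k x"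
proof (induction n)
  case 0
  then show ?case by (simp add: prob_space)
next
  case (Suc n)
  have X: "jump_chain N step x n \<in> measurable (step_algebra {..<n}) (count_space \<Omega>)"
    using assms by (intro jump_chain_measurable step_measurable_algebra) auto
  have XM: "jump_chain N step x n \<in> measurable M (count_space \<Omega>)"
    using assms by (rule jump_chain_meas)
  have "expectation (\<lambda>\<omega>. eigfun k (jump_chain N step x (Suc n) \<omega>)) =
    (\<integral>z. eigval k * eigfun k z \<partial>distr M (count_space \<Omega>) (jump_chain N step x n))"
    using expectation_mult_step[OF X, of "eigfun k" "real N"] abs_eigfun_le
    by (simp del: Bochner_Integration.integral_mult_right_zero Bochner_Integration.integral_mult_right)
       (intro Bochner_Integration.integral_cong refl, simp add: expectation_eigfun_step)
  also have "\<dots> = expectation (\<lambda>\<omega>. eigval k * eigfun k (jump_chain N step x n \<omega>))"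
    by (rule integral_distr[OF XM]) simp
  also have "\<dots> = eigval k ^ Suc n * eigfun k x" using Suc by simp
  finally show ?case .
qed

lemma prob_jump_chain_hier_ball:
  assumes "x \<in> \<Omega>"
  shows "real N * prob {\<omega> \<in> space M. jump_chain N step x n \<omega> \<in> hier_ball N k} -
    prob {\<omega> \<in> space M. jump_chain N step x n \<omega> \<in> hier_ball N (Suc k)} = eigval k ^ n * eigfun k x"
  using expectation_eigfun[OF jump_chain_meas] expectation_eigfun_jump_chain assms by simp

text \<open>The spectral representation of the chain, by telescoping the eigenvalue identity over
  the radius; the ball of radius 0 is the origin alone.\<close>

lemma prob_jump_chain_eq_one_sums:
  assumes "x \<in> \<Omega>"
  shows "(\<lambda>k. eigval k ^ n * eigfun k x / real N ^ Suc k) sums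
    prob {\<omega> \<in> space M. jump_chain N step x n \<omega> = \<one>\<^bsub>hier_group N\<^esub>}"
  using sums_geometric_telescope[of "real N"
      "\<lambda>k. prob {\<omega> \<in> space M. jump_chain N step x n \<omega> \<in> hier_ball N k}",
      OF _ _ _ prob_jump_chain_hier_ball[OF assms]] N2
  by (simp add: hier_ball_0)

lemma jump_chain_left_translate:
  assumes "a \<in> \<Omega>" "x \<in> \<Omega>" "\<omega> \<in> space M"
  shows "jump_chain N step (a \<otimes>\<^bsub>hier_group N\<^esub> x) n \<omega> = a \<otimes>\<^bsub>hier_group N\<^esub> jump_chain N step x n \<omega>"
  using assms jump_chain_in[OF assms(2,3)] step_in by (induction n) (auto simp: G.m_assoc)

text \<open>Left translation by the inverse of y commutes with the chain, so only the origin is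
  needed as a target.\<close>

lemma jump_chain_eq_iff:
  assumes "x \<in> \<Omega>" "y \<in> \<Omega>" "\<omega> \<in> space M"
  shows "jump_chain N step x n \<omega> = y \<longleftrightarrow>
    jump_chain N step (inv\<^bsub>hier_group N\<^esub> y \<otimes>\<^bsub>hier_group N\<^esub> x) n \<omega> = \<one>\<^bsub>hier_group N\<^esub>"
proof -
  have "jump_chain N step (inv\<^bsub>hier_group N\<^esub> y \<otimes>\<^bsub>hier_group N\<^esub> x) n \<omega> =
      inv\<^bsub>hier_group N\<^esub> y \<otimes>\<^bsub>hier_group N\<^esub> jump_chain N step x n \<omega>"
    using assms by (intro jump_chain_left_translate) auto
  then show ?thesis
    using assms jump_chain_in[OF assms(1,3), of n]
    by (metis G.inv_closed G.inv_equality G.inv_inv G.l_inv)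
qed

lemma rate_summable: "summable (\<lambda>j. r (Suc j))" using r_sums by (rule sums_summable)

lemma one_minus_eigval: "1 - eigval k = (\<Sum>j. r (Suc (j + k))) + r (Suc k) / (real N - 1)"
proof -
  have "(\<Sum>j. r (Suc (j + k))) = 1 - (\<Sum>j<k. r (Suc j))"
    using suminf_minus_initial_segment[OF rate_summable, of k] r_sums by (simp add: sums_iff)
  then show ?thesis by (simp add: eigval_def)
qed

text \<open>As N - 1 \<ge> 1, the extra term in \<open>one_minus_eigval\<close> lies between 0 and
  \<open>r (Suc k)\<close>, which is the first term of the tail.\<close>

lemma eigval_bounds: "r (Suc k) \<le> 1 - eigval k" "1 - eigval k \<le> 2 * (\<Sum>j. r (Suc (j + k)))" 
    "(\<Sum>j. r (Suc (j + k))) \<le> 1"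
proof -
  have s: "summable (\<lambda>j. r (Suc (j + k)))"
    using summable_iff_shift[of "\<lambda>j. r (Suc j)" k] rate_summable by simp
  have nn: "0 \<le> r (Suc j)" for j using r_pos[of "Suc j"] by simp
  have 1: "r (Suc k) \<le> (\<Sum>j. r (Suc (j + k)))"
    using sum_le_suminf[OF s, of "{0}"] nn by simp
  have 2: "r (Suc k) / (real N - 1) \<le> r (Suc k)" "0 \<le> r (Suc k) / (real N - 1)"
    using N2 nn[of k] by (auto simp: divide_le_eq mult_le_cancel_left1)
  have "(\<Sum>j. r (Suc (j + k))) = 1 - (\<Sum>j<k. r (Suc j))"
    using suminf_minus_initial_segment[OF rate_summable, of k] r_sums by (simp add: sums_iff)
  moreover have "(\<Sum>j<k. r (Suc j)) \<ge> 0" by (intro sum_nonneg nn)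
  ultimately show "r (Suc k) \<le> 1 - eigval k" "1 - eigval k \<le> 2 * (\<Sum>j. r (Suc (j + k)))" 
    "(\<Sum>j. r (Suc (j + k))) \<le> 1"
    using 1 2 by (auto simp: one_minus_eigval)
qed

end

section \<open>Fractional potentials\<close>

text \<open>The substitution t to l t in Euler's integral for the Gamma function.\<close>

lemma nn_integral_powr_exp:
  fixes s l :: real
  assumes "s > 0" "l > 0"
  shows "(\<integral>\<^sup>+t. ennreal (t powr (s - 1) * exp (- l * t)) * indicator {0<..} t \<partial>lborel) =
    ennreal (Gamma s * l powr - s)"
proof -
  let ?g = "\<lambda>t. ennreal (indicator {0<..} t * t powr (s - 1) * exp (- t))"
  have "ennreal (Gamma s) = (\<integral>\<^sup>+t. ennreal (indicator {0..} t * t powr (s - 1) / exp t) \<partial>lborel)"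
    by (rule Gamma_conv_nn_integral_real) fact
  also have "\<dots> = (\<integral>\<^sup>+t. ?g t \<partial>lborel)"
    by (intro nn_integral_cong) (auto simp: indicator_def exp_minus field_simps)
  also have "\<dots> = ennreal \<bar>l\<bar> * (\<integral>\<^sup>+t. ?g (0 + l * t) \<partial>lborel)"
    using assms by (intro nn_integral_real_affine) auto
  also have "(\<integral>\<^sup>+t. ?g (0 + l * t) \<partial>lborel) =
      (\<integral>\<^sup>+t. ennreal (l powr (s - 1)) * (ennreal (t powr (s - 1) * exp (- l * t)) * indicator {0<..} t) \<partial>lborel)"
    using assms
    by (intro nn_integral_cong)
       (auto simp: indicator_def powr_mult zero_less_mult_iff ennreal_mult[symmetric] mult_ac)
  also have "\<dots> = ennreal (l powr (s - 1)) *
      (\<integral>\<^sup>+t. ennreal (t powr (s - 1) * exp (- l * t)) * indicator {0<..} t \<partial>lborel)" (is "_ = _ * ?I")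
    by (rule nn_integral_cmult) measurable
  finally have "ennreal (Gamma s) = ennreal (l powr s) * ?I"
    using assms by (simp add: ennreal_mult[symmetric] mult.assoc[symmetric] powr_diff)
  then have "ennreal (l powr - s) * ennreal (Gamma s) = (ennreal (l powr - s) * ennreal (l powr s)) * ?I"
    by (simp add: mult.assoc)
  also have "ennreal (l powr - s) * ennreal (l powr s) = 1"
    using assms by (simp add: ennreal_mult[symmetric] powr_add[symmetric])
  finally show ?thesis
    using assms by (simp add: ennreal_mult[symmetric] Gamma_real_pos less_imp_le mult.commute)
qed

lemma suminf_ennreal_finite_iff:
  assumes "\<And>k. 0 \<le> f k"
  shows "(\<Sum>k. ennreal (f k)) < \<infinity> \<longleftrightarrow> summable f"
proof
  assume "(\<Sum>k. ennreal (f k)) < \<infinity>"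
  then show "summable f" using assms by (intro summable_suminf_not_top) auto
next
  assume "summable f"
  then show "(\<Sum>k. ennreal (f k)) < \<infinity>"
    unfolding infinity_ennreal_def
    by (intro less_top[THEN iffD1] ennreal_suminf_neq_top assms)
qed

text \<open>The Poisson generating function. It turns powers of an eigenvalue of the chain into
  exponentials in continuous time.\<close>

lemma poisson_sums: "(\<lambda>n. exp (- t) * t ^ n / fact n * q ^ n) sums exp (- (1 - q) * t)" for t q :: real
proof -
  have "(\<lambda>n. exp (- t) * ((q * t) ^ n /\<^sub>R fact n)) sums (exp (- t) * exp (q * t))"
    by (intro sums_mult exp_converges)
  moreover have "exp (- t) * exp (q * t) = exp (- (1 - q) * t)"
    by (simp add: exp_add[symmetric] algebra_simps)
  ultimately show ?thesis by (simp add: power_mult_distrib divide_inverse mult_ac)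
qed

section \<open>Jump times, the Poisson number of jumps and the law of the walk\<close>

context hier_walk begin

text \<open>The time of the n-th jump counted from 1, with \<open>arrival 0\<close> equal to 0. The
  indexing in \<open>jump_count\<close> is shifted by one against it.\<close>

definition arrival :: "nat \<Rightarrow> 'w \<Rightarrow> real" where
  "arrival n \<omega> = (\<Sum>k<n. hold k \<omega>)"

lemma arrival_Suc: "arrival (Suc n) \<omega> = arrival n \<omega> + hold n \<omega>"
  by (simp add: arrival_def)

lemma jump_count_arrival: "jump_count hold t \<omega> = card {n. arrival (Suc n) \<omega> \<le> t}"
  by (simp add: jump_count_def arrival_def lessThan_Suc_atMost)

text \<open>The almost sure event without instantaneous jumps and without explosion. On it
  \<open>jump_count\<close> inverts \<open>arrival\<close>, and \<open>card\<close> is never applied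
  to an infinite set.\<close>

definition regular :: "'w \<Rightarrow> bool" where
  "regular \<omega> \<longleftrightarrow> (\<forall>k. hold k \<omega> > 0) \<and> (\<forall>t. \<exists>n. t < arrival n \<omega>)"

lemma regular_arrival_less_iff:
  assumes "regular \<omega>" shows "arrival m \<omega> < arrival n \<omega> \<longleftrightarrow> m < n"
    and "arrival m \<omega> \<le> arrival n \<omega> \<longleftrightarrow> m \<le> n"
proof -
  have sm: "strict_mono (\<lambda>n. arrival n \<omega>)"
    using assms by (intro strict_mono_Suc_iff[THEN iffD2]) (auto simp: regular_def arrival_Suc)
  show "arrival m \<omega> < arrival n \<omega> \<longleftrightarrow> m < n" by (rule strict_mono_less[OF sm])
  show "arrival m \<omega> \<le> arrival n \<omega> \<longleftrightarrow> m \<le> n" by (rule strict_mono_less_eq[OF sm])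
qed

lemma regular_jump_count_iff:
  assumes "regular \<omega>" "t \<ge> 0"
  shows "jump_count hold t \<omega> = n \<longleftrightarrow> arrival n \<omega> \<le> t \<and> t < arrival (Suc n) \<omega>"
proof -
  \<comment> \<open>The set counted by \<open>jump_count\<close> will turn out to be the initial
    segment below m.\<close>
  define m where "m = (LEAST m. t < arrival (Suc m) \<omega>)"
  obtain k where k: "t < arrival k \<omega>" using assms by (auto simp: regular_def)
  with assms(2) have "k \<noteq> 0" by (auto simp: arrival_def intro!: Nat.gr0I)
  with k have ex: "t < arrival (Suc (k - 1)) \<omega>" by simp
  have m1: "t < arrival (Suc m) \<omega>" unfolding m_def by (rule LeastI, rule ex)
  have m2: "arrival (Suc j) \<omega> \<le> t" if "j < m" for j
    using not_less_Least[of j] that unfolding m_def by (metis not_le)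
  have m3: "arrival m \<omega> \<le> t" using m2[of "m - 1"] assms(2) by (cases m) (auto simp: arrival_def)
  have "{n. arrival (Suc n) \<omega> \<le> t} = {..<m}"
  proof safe
    fix n assume "arrival (Suc n) \<omega> \<le> t"
    with m1 have "arrival (Suc n) \<omega> < arrival (Suc m) \<omega>" by linarith
    then show "n < m" using regular_arrival_less_iff[OF assms(1)] by simp
  qed (use m2 in auto)
  then have jc: "jump_count hold t \<omega> = m" by (simp add: jump_count_arrival)
  show ?thesis
  proof
    assume "jump_count hold t \<omega> = n"
    then show "arrival n \<omega> \<le> t \<and> t < arrival (Suc n) \<omega>" using jc m1 m3 by simp
  next
    assume n: "arrival n \<omega> \<le> t \<and> t < arrival (Suc n) \<omega>"
    then have "arrival n \<omega> < arrival (Suc m) \<omega>" "arrival m \<omega> < arrival (Suc n) \<omega>"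
      using m1 m3 by linarith+
    then have "n = m" using regular_arrival_less_iff[OF assms(1)] by simp
    then show "jump_count hold t \<omega> = n" using jc by simp
  qed
qed

lemma arrival_measurable: "arrival n \<in> borel_measurable hold_algebra"
  unfolding arrival_def[abs_def] by (intro borel_measurable_sum hold_measurable_algebra)

lemma arrival_borel: "arrival n \<in> borel_measurable M"
  unfolding arrival_def[abs_def] by (intro borel_measurable_sum hold_borel)

lemma indep_hold: "indep_vars (\<lambda>_. borel) hold UNIV"
proof -
  have "indep_vars (\<lambda>_. borel) (\<lambda>k \<omega>. fst (hold k \<omega>, step k \<omega>)) UNIV"
    by (rule indep_vars_compose2[OF pairs_indep]) auto
  then show ?thesis by simp
qed

text \<open>A sum of n independent unit exponentials is Erlang distributed for n \<ge> 1; the empty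
  sum is treated separately.\<close>

lemma prob_arrival_le:
  assumes "t \<ge> 0"
  shows "prob {\<omega> \<in> space M. arrival n \<omega> \<le> t} = 1 - (\<Sum>m<n. exp (- t) * t ^ m / fact m)"
proof (cases n)
  case 0
  then show ?thesis using assms by (simp add: arrival_def prob_space)
next
  case (Suc k)
  have "distributed M lborel (\<lambda>\<omega>. \<Sum>i<n. hold i \<omega>) (erlang_density (card {..<n} - 1) 1)"
    using Suc hold_distributed
    by (intro exponential_distributed_sum indep_vars_subset[OF indep_hold]) auto
  then have "distributed M lborel (arrival n) (erlang_density k 1)"
    using Suc by (simp add: arrival_def[abs_def])
  from erlang_distributed_le[OF this, of t] assms Suc show ?thesis
    by (simp add: erlang_CDF_def lessThan_Suc_atMost mult_ac)
qed

lemma AE_regular: "AE \<omega> in M. regular \<omega>"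
proof -
  have 1: "AE \<omega> in M. \<forall>k. hold k \<omega> > 0"
  proof (subst AE_all_countable, rule allI)
    fix k
    have ev: "{\<omega> \<in> space M. hold k \<omega> \<le> 0} \<in> events"
      using hold_borel[of k] by simp
    have "prob {\<omega> \<in> space M. hold k \<omega> \<le> 0} = 0"
      using exponential_distributedD_le[OF hold_distributed, of 0] by simp
    then have "AE \<omega> in M. \<omega> \<notin> {\<omega> \<in> space M. hold k \<omega> \<le> 0}"
      using ev by (simp add: prob_eq_0)
    then show "AE \<omega> in M. hold k \<omega> > 0"
      by (rule AE_mp) (auto simp: not_le intro!: AE_I2)
  qed
  have 2: "AE \<omega> in M. \<forall>i::nat. \<exists>n. real i < arrival n \<omega>"
  proof (subst AE_all_countable, rule allI)
    fix i :: nat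
    define E where "E = {\<omega> \<in> space M. \<forall>n. arrival n \<omega> \<le> real i}"
    have E: "E \<in> events" unfolding E_def using arrival_borel by measurable
    have le: "prob E \<le> 1 - (\<Sum>m<n. exp (- real i) * real i ^ m / fact m)" for n
      unfolding prob_arrival_le[of "real i" n, OF of_nat_0_le_iff, symmetric]
      using arrival_borel[of n] by (intro finite_measure_mono) (auto simp: E_def)
    \<comment> \<open>Non-explosion: the Poisson weights sum to 1, which is the case q = 1 of
      \<open>poisson_sums\<close>.\<close>
    have "(\<lambda>n. 1 - (\<Sum>m<n. exp (- real i) * real i ^ m / fact m)) \<longlonglongrightarrow> 1 - 1"
      using poisson_sums[of "real i" 1] by (intro tendsto_intros) (simp add: sums_def)
    then have "prob E \<le> 1 - 1" by (rule LIMSEQ_le_const) (use le in blast)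
    then have "prob E = 0" using measure_nonneg[of M E] by simp
    then have "AE \<omega> in M. \<omega> \<notin> E" using E by (simp add: prob_eq_0)
    then show "AE \<omega> in M. \<exists>n. real i < arrival n \<omega>"
      by (rule AE_mp) (auto simp: E_def not_le intro!: AE_I2)
  qed
  show ?thesis
    using 1 2
  proof eventually_elim
    case (elim \<omega>)
    have "\<exists>n. t < arrival n \<omega>" for t
    proof -
      obtain i where "t < real i" using reals_Archimedean2 by blast
      then show ?thesis using elim(2) by (meson less_trans)
    qed
    then show ?case using elim(1) by (simp add: regular_def)
  qed
qed

lemma jump_count_measurable: "jump_count hold t \<in> measurable hold_algebra (count_space UNIV)"
proof -
  have "(\<lambda>\<omega>. card {n. arrival (Suc n) \<omega> \<le> t}) \<in> measurable hold_algebra (count_space UNIV)"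
  proof (rule measurable_card)
    fix i
    have "{\<omega> \<in> space hold_algebra. arrival (Suc i) \<omega> \<le> t} \<in> sets hold_algebra"
      using arrival_measurable by measurable
    then show "{x \<in> space hold_algebra. i \<in> {n. arrival (Suc n) x \<le> t}} \<in> sets hold_algebra" by simp
  qed
  then show ?thesis by (simp add: jump_count_arrival[abs_def])
qed

lemma jump_count_event: "{\<omega> \<in> space M. jump_count hold t \<omega> = n} \<in> sets hold_algebra"
  using measurable_sets[OF jump_count_measurable, of "{n}" t] by (simp add: vimage_def Int_def conj_commute)

text \<open>Exactly n jumps by time t means that the n-th has occurred and the next has not; the
  difference of the two Erlang distribution functions is one Poisson weight.\<close>

lemma prob_jump_count:
  assumes "t \<ge> 0"
  shows "prob {\<omega> \<in> space M. jump_count hold t \<omega> = n} = exp (- t) * t ^ n / fact n"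
proof -
  let ?A = "\<lambda>n. {\<omega> \<in> space M. arrival n \<omega> \<le> t}"
  have A: "?A n \<in> events" for n using arrival_borel by measurable
  have "prob {\<omega> \<in> space M. jump_count hold t \<omega> = n} = prob (?A n - ?A (Suc n))"
  proof (rule finite_measure_eq_AE)
    show "AE x in M. (x \<in> {\<omega> \<in> space M. jump_count hold t \<omega> = n}) = (x \<in> ?A n - ?A (Suc n))"
      using AE_regular by eventually_elim (auto simp: regular_jump_count_iff[OF _ assms])
  qed (use A jump_count_event sets_algebras_subset in auto)
  also have "\<dots> = prob (?A n) - prob (?A n \<inter> ?A (Suc n))"
    using A by (subst finite_measure_Diff') auto
  also have "prob (?A n \<inter> ?A (Suc n)) = prob (?A (Suc n))"
  proof (rule finite_measure_eq_AE)
    show "AE x in M. (x \<in> ?A n \<inter> ?A (Suc n)) = (x \<in> ?A (Suc n))"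
      using AE_regular
    proof eventually_elim
      case (elim x)
      then show ?case using regular_arrival_less_iff(1)[OF elim, of n "Suc n"] by auto
    qed
  qed (use A in auto)
  finally show ?thesis by (simp add: prob_arrival_le[OF assms])
qed

text \<open>Split by the number of jumps, which is measurable in the holding times and hence
  independent of the chain.\<close>

lemma prob_walk_sums:
  assumes "t \<ge> 0" "x \<in> \<Omega>" "B \<subseteq> \<Omega>"
  shows "(\<lambda>n. exp (- t) * t ^ n / fact n * prob {\<omega> \<in> space M. jump_chain N step x n \<omega> \<in> B}) sums
    prob {\<omega> \<in> space M. walk N hold step x t \<omega> \<in> B}"
proof -
  let ?J = "\<lambda>n. {\<omega> \<in> space M. jump_count hold t \<omega> = n}"
  let ?C = "\<lambda>n. {\<omega> \<in> space M. jump_chain N step x n \<omega> \<in> B}"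
  have C: "?C n \<in> sets (step_algebra UNIV)" for n
  proof -
    have "jump_chain N step x n \<in> measurable (step_algebra UNIV) (count_space \<Omega>)"
      using assms by (intro jump_chain_measurable step_measurable_algebra) auto
    from measurable_sets[OF this, of B] assms(3) show ?thesis
      by (simp add: vimage_def Int_def conj_commute)
  qed
  have "(\<lambda>n. prob (?J n \<inter> ?C n)) sums prob (\<Union>n. ?J n \<inter> ?C n)"
  proof (rule finite_measure_UNION)
    show "range (\<lambda>n. ?J n \<inter> ?C n) \<subseteq> events"
      using C jump_count_event sets_algebras_subset by blast
  qed (auto simp: disjoint_family_on_def)
  moreover have "(\<Union>n. ?J n \<inter> ?C n) = {\<omega> \<in> space M. walk N hold step x t \<omega> \<in> B}"
    by (auto simp: walk_def)
  moreover have "prob (?J n \<inter> ?C n) = exp (- t) * t ^ n / fact n * prob (?C n)" for n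
    using indep_setD[OF indep_hold_step_algebra jump_count_event C] prob_jump_count[OF assms(1)] by simp
  ultimately show ?thesis by simp
qed

text \<open>The same telescoping as for the chain, applied to Poisson mixtures of its ball
  probabilities.\<close>

lemma prob_walk_eq_one_sums:
  assumes "t \<ge> 0" "x \<in> \<Omega>"
  shows "(\<lambda>k. exp (- (1 - eigval k) * t) * eigfun k x / real N ^ Suc k) sums
    prob {\<omega> \<in> space M. walk N hold step x t \<omega> = \<one>\<^bsub>hier_group N\<^esub>}"
proof -
  define F where "F k = prob {\<omega> \<in> space M. walk N hold step x t \<omega> \<in> hier_ball N k}" for k
  have "(\<lambda>k. exp (- (1 - eigval k) * t) * eigfun k x / real N ^ Suc k) sums F 0"
  proof (rule sums_geometric_telescope)
    fix k
    have "(\<lambda>n. real N * (exp (- t) * t ^ n / fact n * prob {\<omega> \<in> space M. jump_chain N step x n \<omega> \<in> hier_ball N k})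
        - exp (- t) * t ^ n / fact n * prob {\<omega> \<in> space M. jump_chain N step x n \<omega> \<in> hier_ball N (Suc k)})
      sums (real N * F k - F (Suc k))"
      unfolding F_def by (intro sums_diff sums_mult prob_walk_sums assms hier_ball_subset)
    then have "(\<lambda>n. exp (- t) * t ^ n / fact n * (eigval k ^ n * eigfun k x)) sums (real N * F k - F (Suc k))"
      unfolding prob_jump_chain_hier_ball[OF assms(2), symmetric] by (simp add: algebra_simps)
    moreover have "(\<lambda>n. exp (- t) * t ^ n / fact n * (eigval k ^ n * eigfun k x)) sums
        (exp (- (1 - eigval k) * t) * eigfun k x)"
      using sums_mult2[OF poisson_sums[of t "eigval k"], of "eigfun k x"] by (simp add: mult_ac)
    ultimately show "real N * F k - F (Suc k) = exp (- (1 - eigval k) * t) * eigfun k x"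
      by (rule sums_unique2)
  qed (use N2 in \<open>auto simp: F_def\<close>)
  then show ?thesis using N1 by (simp add: F_def hier_ball_0)
qed

section \<open>Return probabilities and finiteness of fractional potentials\<close>

lemma trans_prob_eq:
  assumes "x \<in> \<Omega>" "y \<in> \<Omega>"
  shows "trans_prob M N hold step t x y = prob {\<omega> \<in> space M.
    walk N hold step (inv\<^bsub>hier_group N\<^esub> y \<otimes>\<^bsub>hier_group N\<^esub> x) t \<omega> = \<one>\<^bsub>hier_group N\<^esub>}"
  unfolding trans_prob_def walk_def using jump_chain_eq_iff[OF assms] by (intro arg_cong[where f = prob]) auto

definition weight :: "nat \<Rightarrow> real" where
  "weight k = (real N - 1) / real N ^ Suc k"

lemma weight_pos: "weight k > 0" using N2 by (simp add: weight_def)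

definition green_density :: "real \<Rightarrow> real" where
  "green_density t = trans_prob M N hold step t \<one>\<^bsub>hier_group N\<^esub> \<one>\<^bsub>hier_group N\<^esub>"

lemma green_density_sums:
  "t \<ge> 0 \<Longrightarrow> (\<lambda>k. weight k * exp (- (1 - eigval k) * t)) sums green_density t"
  using prob_walk_eq_one_sums[of t "\<one>\<^bsub>hier_group N\<^esub>"]
  by (simp add: green_density_def trans_prob_eq eigfun_one weight_def mult_ac)

text \<open>The spectral series are compared term by term, since every eigenfunction is largest at
  the origin.\<close>

lemma trans_prob_le:
  assumes "x \<in> \<Omega>" "y \<in> \<Omega>" "t \<ge> 0"
  shows "trans_prob M N hold step t x y \<le> green_density t"
proof (rule sums_le[OF _ _ green_density_sums[OF assms(3)]])
  let ?z = "inv\<^bsub>hier_group N\<^esub> y \<otimes>\<^bsub>hier_group N\<^esub> x"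
  show "(\<lambda>k. exp (- (1 - eigval k) * t) * eigfun k ?z / real N ^ Suc k) sums trans_prob M N hold step t x y"
    unfolding trans_prob_eq[OF assms(1,2)] using assms by (intro prob_walk_eq_one_sums) auto
  fix k
  have "exp (- (1 - eigval k) * t) * eigfun k ?z / real N ^ Suc k \<le>
      exp (- (1 - eigval k) * t) * (real N - 1) / real N ^ Suc k"
    by (intro divide_right_mono mult_left_mono eigfun_le) auto
  then show "exp (- (1 - eigval k) * t) * eigfun k ?z / real N ^ Suc k \<le> weight k * exp (- (1 - eigval k) * t)"
    by (simp add: weight_def mult_ac)
qed

lemma one_minus_eigval_pos: "1 - eigval k > 0"
  using eigval_bounds(1)[of k] r_pos[of "Suc k"] by simp

text \<open>Writing the integrand as a series of nonnegative measurable functions gives its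
  measurability in t and prepares the exchange of sum and integral. For t \<le> 0 both sides
  vanish.\<close>

lemma green_density_integrand:
  "ennreal (t powr (s - 1)) * ennreal (green_density t) * indicator {0<..} t =
    (\<Sum>k. ennreal (weight k) * (ennreal (t powr (s - 1) * exp (- (1 - eigval k) * t)) * indicator {0<..} t))"
proof (cases "t > 0")
    case True
    have "(\<lambda>k. t powr (s - 1) * (weight k * exp (- (1 - eigval k) * t))) sums (t powr (s - 1) * green_density t)"
      using True by (intro sums_mult green_density_sums) auto
    then have "(\<Sum>k. ennreal (t powr (s - 1) * (weight k * exp (- (1 - eigval k) * t)))) =
        ennreal (t powr (s - 1) * green_density t)"
      using weight_pos[THEN less_imp_le] by (intro suminf_ennreal_eq) auto
    moreover have "green_density t \<ge> 0" by (simp add: green_density_def trans_prob_def)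
    ultimately show ?thesis using True weight_pos
      by (simp add: ennreal_mult less_imp_le mult_ac)
qed simp

lemma borel_measurable_green_density_integrand:
  "(\<lambda>t. ennreal (t powr (s - 1)) * ennreal (green_density t) * indicator {0<..} t) \<in> borel_measurable lborel"
  unfolding green_density_integrand by measurable

lemma nn_integral_green_density:
  assumes "s > 0"
  shows "(\<integral>\<^sup>+t. ennreal (t powr (s - 1)) * ennreal (green_density t) * indicator {0<..} t \<partial>lborel) =
    (\<Sum>k. ennreal (Gamma s * (weight k * (1 - eigval k) powr - s)))"
proof -
  let ?f = "\<lambda>k t. ennreal (weight k) *
    (ennreal (t powr (s - 1) * exp (- (1 - eigval k) * t)) * indicator {0<..} t)"
  have "(\<integral>\<^sup>+t. ennreal (t powr (s - 1)) * ennreal (green_density t) * indicator {0<..} t \<partial>lborel) =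
    (\<integral>\<^sup>+t. (\<Sum>k. ?f k t) \<partial>lborel)" by (simp only: green_density_integrand)
  also have "\<dots> = (\<Sum>k. \<integral>\<^sup>+t. ?f k t \<partial>lborel)"
    by (rule nn_integral_suminf) measurable
  also have "\<dots> = (\<Sum>k. ennreal (Gamma s * (weight k * (1 - eigval k) powr - s)))"
  proof (rule suminf_cong)
    fix k
    have "(\<integral>\<^sup>+t. ?f k t \<partial>lborel) = ennreal (weight k) *
        (\<integral>\<^sup>+t. ennreal (t powr (s - 1) * exp (- (1 - eigval k) * t)) * indicator {0<..} t \<partial>lborel)"
      by (rule nn_integral_cmult) measurable
    also have "\<dots> = ennreal (weight k) * ennreal (Gamma s * (1 - eigval k) powr - s)"
      using nn_integral_powr_exp[OF assms one_minus_eigval_pos] by simp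
    finally show "(\<integral>\<^sup>+t. ?f k t \<partial>lborel) = ennreal (Gamma s * (weight k * (1 - eigval k) powr - s))"
      using weight_pos[of k] assms by (simp add: ennreal_mult[symmetric] Gamma_real_pos less_imp_le mult_ac)
  qed
  finally show ?thesis .
qed

lemma nn_integral_green_density_finite_iff:
  assumes "s > 0"
  shows "(\<integral>\<^sup>+t. ennreal (t powr (s - 1)) * ennreal (green_density t) * indicator {0<..} t \<partial>lborel) < \<infinity> \<longleftrightarrow>
    summable (\<lambda>k. weight k * (1 - eigval k) powr - s)"
proof -
  have nn: "0 \<le> Gamma s * (weight k * (1 - eigval k) powr - s)" for k
    using weight_pos[of k] Gamma_real_pos[OF assms] by simp
  have "(\<Sum>k. ennreal (Gamma s * (weight k * (1 - eigval k) powr - s))) < \<infinity> \<longleftrightarrow>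
      summable (\<lambda>k. Gamma s * (weight k * (1 - eigval k) powr - s))"
    by (rule suminf_ennreal_finite_iff[OF nn])
  also have "\<dots> \<longleftrightarrow> summable (\<lambda>k. weight k * (1 - eigval k) powr - s)"
    using Gamma_real_pos[OF assms] by (subst summable_cmult_iff) auto
  finally show ?thesis by (simp add: nn_integral_green_density[OF assms])
qed

text \<open>In one direction the indicator of the origin is tested at the origin. In the other,
  \<open>trans_prob_le\<close> bounds the semigroup by the return probability times the finite sum
  of \<phi> over its support.\<close>

lemma finite_potential_iff:
  assumes "s > 0"
  shows "finite_potential (trans_prob M N hold step) \<Omega> s \<longleftrightarrow> summable (\<lambda>k. weight k * (1 - eigval k) powr - s)"
proof
  assume fin: "finite_potential (trans_prob M N hold step) \<Omega> s"
  let ?o = "\<one>\<^bsub>hier_group N\<^esub>"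
  let ?\<phi> = "\<lambda>x. if x = ?o then 1 else 0 :: real"
  have "finite {x \<in> \<Omega>. ?\<phi> x \<noteq> 0}" by (rule finite_subset[of _ "{?o}"]) auto
  then have "frac_potential (trans_prob M N hold step) \<Omega> s ?\<phi> ?o < \<infinity>"
    using fin unfolding finite_potential_def by auto
  moreover have "semigroup_op (trans_prob M N hold step) \<Omega> t ?\<phi> ?o = ennreal (green_density t)" for t
    unfolding semigroup_op_def green_density_def
    by (subst nn_integral_count_space'[where A = "{?o}"]) auto
  ultimately have "ennreal (1 / Gamma s) *
      (\<integral>\<^sup>+t. ennreal (t powr (s - 1)) * ennreal (green_density t) * indicator {0<..} t \<partial>lborel) < \<infinity>"
    by (simp add: frac_potential_def)
  then have "(\<integral>\<^sup>+t. ennreal (t powr (s - 1)) * ennreal (green_density t) * indicator {0<..} t \<partial>lborel) < \<infinity>"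
    using Gamma_real_pos[OF assms] by (auto simp: ennreal_mult_less_top)
  then show "summable (\<lambda>k. weight k * (1 - eigval k) powr - s)"
    using nn_integral_green_density_finite_iff[OF assms] by simp
next
  assume "summable (\<lambda>k. weight k * (1 - eigval k) powr - s)"
  then have fin: "(\<integral>\<^sup>+t. ennreal (t powr (s - 1)) * ennreal (green_density t) * indicator {0<..} t \<partial>lborel) < \<infinity>"
    using nn_integral_green_density_finite_iff[OF assms] by simp
  show "finite_potential (trans_prob M N hold step) \<Omega> s"
    unfolding finite_potential_def
  proof (intro allI impI ballI)
    fix \<phi> :: "(nat \<Rightarrow> int) \<Rightarrow> real" and x
    assume \<phi>: "(\<forall>x\<in>\<Omega>. 0 \<le> \<phi> x) \<and> finite {x \<in> \<Omega>. \<phi> x \<noteq> 0}" and x: "x \<in> \<Omega>"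
    define S where "S = {x \<in> \<Omega>. \<phi> x \<noteq> 0}"
    have S: "finite S" "S \<subseteq> \<Omega>" "\<And>y. y \<in> S \<Longrightarrow> 0 \<le> \<phi> y" using \<phi> by (auto simp: S_def)
    define C where "C = (\<Sum>y\<in>S. ennreal (\<phi> y))"
    have C: "C < \<infinity>" unfolding C_def using S(1) by simp
    have le: "semigroup_op (trans_prob M N hold step) \<Omega> t \<phi> x \<le> ennreal (green_density t) * C" if "t > 0" for t
    proof -
      have "semigroup_op (trans_prob M N hold step) \<Omega> t \<phi> x =
          (\<Sum>y\<in>S. ennreal (trans_prob M N hold step t x y) * ennreal (\<phi> y))"
        unfolding semigroup_op_def using S by (intro nn_integral_count_space') (auto simp: S_def)
      also have "\<dots> \<le> (\<Sum>y\<in>S. ennreal (green_density t) * ennreal (\<phi> y))"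
        using S x that by (intro sum_mono mult_right_mono ennreal_leI trans_prob_le) auto
      finally show ?thesis by (simp add: C_def sum_distrib_left)
    qed
    have "(\<integral>\<^sup>+t. ennreal (t powr (s - 1)) * semigroup_op (trans_prob M N hold step) \<Omega> t \<phi> x * indicator {0<..} t \<partial>lborel) \<le>
        (\<integral>\<^sup>+t. ennreal (t powr (s - 1)) * ennreal (green_density t) * indicator {0<..} t * C \<partial>lborel)"
    proof (rule nn_integral_mono)
      fix t :: real
      show "ennreal (t powr (s - 1)) * semigroup_op (trans_prob M N hold step) \<Omega> t \<phi> x * indicator {0<..} t \<le>
          ennreal (t powr (s - 1)) * ennreal (green_density t) * indicator {0<..} t * C"
        using mult_left_mono[OF le, of t "ennreal (t powr (s - 1))"] by (cases "t > 0") (auto simp: mult_ac)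
    qed
    also have "\<dots> < \<infinity>"
      using fin C borel_measurable_green_density_integrand[of s]
      by (subst nn_integral_multc) (auto simp: ennreal_mult_less_top)
    finally show "frac_potential (trans_prob M N hold step) \<Omega> s \<phi> x < \<infinity>"
      by (simp add: frac_potential_def ennreal_mult_less_top)
  qed
qed

end

section \<open>The last visit to the origin\<close>

lemma jump_chain_shift:
  "jump_chain N s x (k + n) \<omega> = jump_chain N (\<lambda>i. s (k + i)) (jump_chain N s x k \<omega>) n \<omega>"
  by (induction n) auto

text \<open>Exhibits the chain as a fixed function of the step sequence, so that its law depends
  only on the law of that sequence.\<close>

lemma jump_chain_eval: "jump_chain N s x n \<omega> = jump_chain N (\<lambda>i s. s i) x n (\<lambda>i. s i \<omega>)"
  by (induction n) auto

section \<open>Visits of the jump chain to the origin and stretches without a visit\<close>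

context hier_walk begin

abbreviation "origin \<equiv> \<one>\<^bsub>hier_group N\<^esub>"

definition visit :: "nat \<Rightarrow> 'w set" where
  "visit k = {\<omega> \<in> space M. jump_chain N step origin k \<omega> = origin}"

text \<open>The chain is restarted at the origin with the steps from index k on, which makes the
  event independent of the steps before k. For k = 0 it is the event of no return up to step
  n.\<close>

definition avoid :: "nat \<Rightarrow> nat \<Rightarrow> 'w set" where
  "avoid k n = {\<omega> \<in> space M. \<forall>i\<in>{1..n}. jump_chain N (\<lambda>i. step (k + i)) origin i \<omega> \<noteq> origin}"

lemma avoid_0: "avoid 0 n = {\<omega> \<in> space M. \<forall>i\<in>{1..n}. jump_chain N step origin i \<omega> \<noteq> origin}"
  by (simp add: avoid_def)

lemma sets_jump_chain_eq:
  assumes "X \<in> measurable K (count_space \<Omega>)" "space K = space M" "y \<in> \<Omega>"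
  shows "{\<omega> \<in> space M. X \<omega> = y} \<in> sets K"
  using measurable_sets[OF assms(1), of "{y}"] assms(2,3) by (simp add: vimage_def Int_def conj_commute)

lemma visit_sets: "visit k \<in> sets (step_algebra {..<k})" "visit k \<in> events"
proof -
  show "visit k \<in> sets (step_algebra {..<k})" unfolding visit_def
    by (intro sets_jump_chain_eq jump_chain_measurable step_measurable_algebra) auto
  then show "visit k \<in> events" using sets_algebras_subset by blast
qed

lemma sets_avoidI:
  fixes n :: nat
  assumes "\<And>i. X i \<in> measurable K (count_space \<Omega>)"
  shows "{\<omega> \<in> space K. \<forall>i\<in>{1..n}. X i \<omega> \<noteq> origin} \<in> sets K"
proof -
  have "X i -` (\<Omega> - {origin}) \<inter> space K \<in> sets K" for i
    by (rule measurable_sets[OF assms]) auto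
  moreover have "X i -` (\<Omega> - {origin}) \<inter> space K = {\<omega> \<in> space K. X i \<omega> \<noteq> origin}" for i
    using measurable_space[OF assms] by auto
  ultimately show ?thesis by (intro sets.sets_Collect_finite_All) auto
qed

lemma avoid_sets: "avoid k n \<in> sets (step_algebra {k..})" "avoid k n \<in> events"
proof -
  have "{\<omega> \<in> space (step_algebra {k..}). \<forall>i\<in>{1..n}. jump_chain N (\<lambda>i. step (k + i)) origin i \<omega> \<noteq> origin}
      \<in> sets (step_algebra {k..})"
    by (intro sets_avoidI jump_chain_measurable step_measurable_algebra) auto
  then show "avoid k n \<in> sets (step_algebra {k..})" by (simp add: avoid_def)
  then show "avoid k n \<in> events" using sets_algebras_subset by blast
qed

lemma distr_step_eq: "distr M (count_space \<Omega>) (step k) = distr M (count_space \<Omega>) (step 0)"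
proof (rule measure_eqI_countable[of _ \<Omega>])
  fix y assume y: "y \<in> \<Omega>"
  have "emeasure (distr M (count_space \<Omega>) (step j)) {y} = ennreal (step_prob N r y)" for j
  proof -
    have "emeasure (distr M (count_space \<Omega>) (step j)) {y} = emeasure M {\<omega> \<in> space M. step j \<omega> = y}"
      using y by (subst emeasure_distr[OF step_measurable]) (auto intro!: arg_cong2[where f = emeasure])
    then show ?thesis using step_distribution[OF y] by (simp add: emeasure_eq_measure)
  qed
  then show "emeasure (distr M (count_space \<Omega>) (step k)) {y} = emeasure (distr M (count_space \<Omega>) (step 0)) {y}" by simp
qed (auto simp: countable_\<Omega>)

lemma indep_step: "indep_vars (\<lambda>_. count_space \<Omega>) step UNIV"
proof -
  have "indep_vars (\<lambda>_. count_space \<Omega>) (\<lambda>k \<omega>. snd (hold k \<omega>, step k \<omega>)) UNIV"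
    by (rule indep_vars_compose2[OF pairs_indep]) auto
  then show ?thesis by simp
qed

lemma indep_step_shift: "indep_vars (\<lambda>_. count_space \<Omega>) (\<lambda>i. step (k + i)) UNIV"
proof -
  have *: "indep_sets (\<lambda>i. {step i -` A \<inter> space M | A. A \<in> sets (count_space \<Omega>)}) UNIV"
    using indep_step unfolding indep_vars_def2 by blast
  have "indep_sets (\<lambda>i. {step (k + i) -` A \<inter> space M | A. A \<in> sets (count_space \<Omega>)}) UNIV"
  proof (rule indep_setsI)
    fix A :: "nat \<Rightarrow> 'w set" and J :: "nat set"
    assume J: "J \<noteq> {}" "J \<subseteq> UNIV" "finite J"
      and A: "\<forall>j\<in>J. A j \<in> {step (k + j) -` A \<inter> space M | A. A \<in> sets (count_space \<Omega>)}"
    have inj: "inj_on ((+) k) J" by simp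
    have "prob (\<Inter>j\<in>(+) k ` J. A (j - k)) = (\<Prod>j\<in>(+) k ` J. prob (A (j - k)))"
      using J A by (intro indep_setsD[OF *]) auto
    then show "prob (\<Inter>j\<in>J. A j) = (\<Prod>j\<in>J. prob (A j))"
      using inj by (simp add: prod.reindex)
  qed (use measurable_sets[OF step_measurable] in auto)
  then show ?thesis unfolding indep_vars_def2 using step_measurable by blast
qed

text \<open>Every shift of the step sequence has the same product law, and the event is the preimage
  of one fixed set E of sequences.\<close>

lemma prob_avoid: "prob (avoid k n) = prob (avoid 0 n)"
proof -
  let ?S = "count_space \<Omega>"
  let ?P = "\<Pi>\<^sub>M i\<in>(UNIV :: nat set). ?S"
  define E where "E = {s \<in> space ?P. \<forall>i\<in>{1..n}. jump_chain N (\<lambda>i s. s i) origin i s \<noteq> origin}"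
  have E: "E \<in> sets ?P"
    unfolding E_def by (intro sets_avoidI jump_chain_measurable) (auto intro: measurable_component_singleton)
  have "prob (avoid k n) = measure (\<Pi>\<^sub>M i\<in>(UNIV :: nat set). distr M ?S (step 0)) E" for k
  proof -
    have "(\<lambda>\<omega>. \<lambda>i\<in>UNIV. step (k + i) \<omega>) \<in> measurable M ?P"
      by (rule measurable_restrict) (rule step_measurable)
    then have meas: "(\<lambda>\<omega> i. step (k + i) \<omega>) \<in> measurable M ?P" by (simp only: restrict_UNIV)
    have "distr M ?P (\<lambda>\<omega> i. step (k + i) \<omega>) = (\<Pi>\<^sub>M i\<in>UNIV. distr M ?S (step (k + i)))"
      using indep_vars_iff_distr_eq_PiM'[of UNIV "\<lambda>i. step (k + i)" "\<lambda>_. ?S"] step_measurable indep_step_shift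
      by (simp add: restrict_UNIV)
    also have "\<dots> = (\<Pi>\<^sub>M i\<in>UNIV. distr M ?S (step 0))"
      by (intro PiM_cong refl distr_step_eq)
    finally have distr: "distr M ?P (\<lambda>\<omega> i. step (k + i) \<omega>) = (\<Pi>\<^sub>M i\<in>UNIV. distr M ?S (step 0))" .
    have "(\<lambda>\<omega> i. step (k + i) \<omega>) -` E \<inter> space M = avoid k n"
      using step_in
      unfolding avoid_def E_def jump_chain_eval[of N "\<lambda>i. step (k + i)"] by (auto simp: space_PiM)
    then have "prob (avoid k n) = measure (distr M ?P (\<lambda>\<omega> i. step (k + i) \<omega>)) E"
      using measure_distr[OF meas E] by simp
    then show ?thesis by (simp add: distr)
  qed
  then show ?thesis by simp
qed

text \<open>On \<open>visit k\<close> the restarted chain is the continuation of the original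
  one.\<close>

lemma visit_Int_avoid:
  assumes "k \<le> n"
  shows "visit k \<inter> avoid k (n - k) = {\<omega> \<in> visit k. \<forall>j\<in>{k<..n}. jump_chain N step origin j \<omega> \<noteq> origin}"
proof (intro equalityI subsetI)
  fix \<omega> assume \<omega>: "\<omega> \<in> visit k \<inter> avoid k (n - k)"
  have "jump_chain N step origin j \<omega> \<noteq> origin" if "j \<in> {k<..n}" for j
  proof -
    have "j - k \<in> {1..n - k}" using that by auto
    then have "jump_chain N (\<lambda>i. step (k + i)) origin (j - k) \<omega> \<noteq> origin" using \<omega> by (simp add: avoid_def)
    then show ?thesis
      using jump_chain_shift[of N step origin k "j - k" \<omega>] \<omega> that by (simp add: visit_def)
  qed
  then show "\<omega> \<in> {\<omega> \<in> visit k. \<forall>j\<in>{k<..n}. jump_chain N step origin j \<omega> \<noteq> origin}" using \<omega> by simp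
next
  fix \<omega> assume \<omega>: "\<omega> \<in> {\<omega> \<in> visit k. \<forall>j\<in>{k<..n}. jump_chain N step origin j \<omega> \<noteq> origin}"
  have "jump_chain N (\<lambda>i. step (k + i)) origin i \<omega> \<noteq> origin" if "i \<in> {1..n - k}" for i
  proof -
    have "k + i \<in> {k<..n}" using that assms by auto
    then have "jump_chain N step origin (k + i) \<omega> \<noteq> origin" using \<omega> by blast
    then show ?thesis using jump_chain_shift[of N step origin k i \<omega>] \<omega> by (simp add: visit_def)
  qed
  then show "\<omega> \<in> visit k \<inter> avoid k (n - k)" using \<omega> by (simp add: avoid_def visit_def)
qed

text \<open>The events that the last visit up to time n happens at time k partition the space: such
  a visit exists because the chain starts at the origin. Past and future steps are independent,
  which factorises each probability.\<close>

lemma last_visit_decomposition: "(\<Sum>k\<le>n. prob (visit k) * prob (avoid 0 (n - k))) = 1"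
proof -
  let ?L = "\<lambda>k. visit k \<inter> avoid k (n - k)"
  have "prob (visit k) * prob (avoid 0 (n - k)) = prob (?L k)" for k
  proof -
    have "indep_set (sets (step_algebra {..<k})) (sets (step_algebra {k..}))"
      by (rule indep_step_algebra) auto
    from indep_setD[OF this visit_sets(1) avoid_sets(1)] show ?thesis by (simp add: prob_avoid[of k])
  qed
  then have "(\<Sum>k\<le>n. prob (visit k) * prob (avoid 0 (n - k))) = (\<Sum>k\<le>n. prob (?L k))" by simp
  also have "\<dots> = prob (\<Union>k\<le>n. ?L k)"
  proof (rule finite_measure_finite_Union[symmetric])
    show "?L ` {..n} \<subseteq> events" by (intro image_subsetI sets.Int visit_sets avoid_sets)
    show "disjoint_family_on ?L {..n}"
    proof -
      have lt: "?L i \<inter> ?L j = {}" if "i < j" "j \<le> n" for i j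
      proof -
        have "jump_chain N step origin j \<omega> \<noteq> origin" if "\<omega> \<in> ?L i" for \<omega>
          using visit_Int_avoid[of i n] that \<open>i < j\<close> \<open>j \<le> n\<close> by simp
        then show ?thesis by (auto simp: visit_def)
      qed
      show ?thesis unfolding disjoint_family_on_def
      proof (intro ballI impI)
        fix i j assume "i \<in> {..n}" "j \<in> {..n}" "i \<noteq> j"
        then show "?L i \<inter> ?L j = {}"
          using lt[of i j] lt[of j i] by (cases i j rule: linorder_cases) (simp_all add: Int_commute)
      qed
    qed
  qed simp
  also have "(\<Union>k\<le>n. ?L k) = space M"
  proof (intro equalityI subsetI)
    fix \<omega> assume \<omega>: "\<omega> \<in> space M"
    define K where "K = {k. k \<le> n \<and> jump_chain N step origin k \<omega> = origin}"
    have K: "finite K" "0 \<in> K" by (auto simp: K_def)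
    define m where "m = Max K"
    have "m \<in> K" unfolding m_def using K by (intro Max_in) auto
    moreover have "j \<notin> K" if "m < j" for j
      using Max_ge[OF K(1), of j] that unfolding m_def by auto
    ultimately have "\<omega> \<in> ?L m" "m \<le> n"
      using \<omega> visit_Int_avoid[of m n] by (auto simp: K_def visit_def)
    then show "\<omega> \<in> (\<Union>k\<le>n. ?L k)" by auto
  qed (auto simp: visit_def)
  finally show ?thesis by (simp add: prob_space)
qed

text \<open>The eigenvalue is written as 1 - (1 - \<open>eigval k\<close>) to match the form of
  \<open>partial_sums_upper\<close> and \<open>partial_sums_lower\<close>.\<close>

lemma prob_visit_sums: "(\<lambda>k. weight k * (1 - (1 - eigval k)) ^ n) sums prob (visit n)"
  using prob_jump_chain_eq_one_sums[of origin n] by (simp add: visit_def eigfun_one weight_def mult_ac)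

lemma avoid_antimono: "m \<le> n \<Longrightarrow> avoid 0 n \<subseteq> avoid 0 m"
  by (auto simp: avoid_def)

lemma prob_avoid_mult_le: "(\<Sum>k\<le>n. prob (visit k)) * prob (avoid 0 n) \<le> 1"
proof -
  have "(\<Sum>k\<le>n. prob (visit k)) * prob (avoid 0 n) \<le> (\<Sum>k\<le>n. prob (visit k) * prob (avoid 0 (n - k)))"
    unfolding sum_distrib_right
    by (intro sum_mono mult_left_mono finite_measure_mono avoid_antimono avoid_sets) auto
  then show ?thesis by (simp add: last_visit_decomposition)
qed

text \<open>Sum the last-visit identity over n \<le> m, exchange the order of summation, and enlarge
  the triangle of indices to a square.\<close>

lemma sum_prob_avoid_ge: "real (Suc m) \<le> (\<Sum>k\<le>m. prob (visit k)) * (\<Sum>n\<le>m. prob (avoid 0 n))"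
proof -
  have "real (Suc m) = (\<Sum>n\<le>m. \<Sum>k\<le>n. prob (visit k) * prob (avoid 0 (n - k)))"
    by (simp add: last_visit_decomposition)
  also have "\<dots> = (\<Sum>k\<le>m. \<Sum>n\<in>{k..m}. prob (visit k) * prob (avoid 0 (n - k)))"
    by (subst sum.Sigma, simp, simp, subst sum.Sigma, simp, simp)
       (rule sum.reindex_bij_witness[where i = "\<lambda>(a, b). (b, a)" and j = "\<lambda>(a, b). (b, a)"], auto)
  also have "\<dots> \<le> (\<Sum>k\<le>m. \<Sum>n\<le>m. prob (visit k) * prob (avoid 0 n))"
  proof (rule sum_mono)
    fix k assume "k \<in> {..m}"
    then have "(\<Sum>n\<in>{k..m}. prob (visit k) * prob (avoid 0 (n - k))) = (\<Sum>n\<in>{..m - k}. prob (visit k) * prob (avoid 0 n))"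
      by (intro sum.reindex_bij_witness[where i = "\<lambda>n. n + k" and j = "\<lambda>n. n - k"]) auto
    also have "\<dots> \<le> (\<Sum>n\<le>m. prob (visit k) * prob (avoid 0 n))"
      by (intro sum_mono2) auto
    finally show "(\<Sum>n\<in>{k..m}. prob (visit k) * prob (avoid 0 (n - k))) \<le> (\<Sum>n\<le>m. prob (visit k) * prob (avoid 0 n))" .
  qed
  also have "\<dots> = (\<Sum>k\<le>m. prob (visit k)) * (\<Sum>n\<le>m. prob (avoid 0 n))"
    by (rule sum_product[symmetric])
  finally show ?thesis .
qed

end

section \<open>Moments of the return time\<close>

text \<open>The bound is affine in x, so integrating it needs only the mean; with y equal to the
  mean it costs just a factor 2.\<close>

lemma powr_le_tangent:
  fixes x y \<delta> :: real
  assumes "0 \<le> x" "0 < y" "0 \<le> \<delta>" "\<delta> \<le> 1"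
  shows "x powr \<delta> \<le> y powr \<delta> + y powr (\<delta> - 1) * x"
proof (cases "x \<le> y")
  case True
  then have "x powr \<delta> \<le> y powr \<delta>" using assms by (intro powr_mono2) auto
  moreover have "0 \<le> y powr (\<delta> - 1) * x" using assms by simp
  ultimately show ?thesis by linarith
next
  case False
  then have "x powr \<delta> = x powr (\<delta> - 1) * x" using assms by (simp add: powr_diff)
  also have "\<dots> \<le> y powr (\<delta> - 1) * x"
    using False assms by (intro mult_right_mono powr_mono2') auto
  moreover have "0 \<le> y powr \<delta>" by simp
  ultimately show ?thesis by linarith
qed

text \<open>The chord over [0, n] lies below the concave power with exponent
  \<open>min \<delta> 1\<close>, and at positive integers that power is at most the one with
  exponent \<delta>.\<close>

lemma powr_ge_chord:
  fixes x \<delta> :: real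
  assumes "real m \<le> x" "m \<le> n" "0 < \<delta>"
  shows "real n powr (min \<delta> 1 - 1) * real m \<le> x powr \<delta>"
proof (cases "m = 0")
  case False
  have "real n powr (min \<delta> 1 - 1) * real m \<le> real m powr (min \<delta> 1 - 1) * real m"
    using assms False by (intro mult_right_mono powr_mono2') auto
  also have "\<dots> = real m powr min \<delta> 1" using False by (simp add: powr_diff)
  also have "\<dots> \<le> real m powr \<delta>" using False by (intro powr_mono) auto
  also have "\<dots> \<le> x powr \<delta>" using assms by (intro powr_mono2) auto
  finally show ?thesis .
qed simp

text \<open>Each summand is at least \<open>real n powr (\<delta> - 1)\<close>. This will express a
  power of the first return index through the events of no return.\<close>

lemma powr_le_sum_powr:
  fixes \<delta> :: real
  assumes "0 < \<delta>" "\<delta> \<le> 1"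
  shows "real n powr \<delta> \<le> (\<Sum>m<n. real (Suc m) powr (\<delta> - 1))"
proof (cases "n = 0")
  case False
  then have "real n powr \<delta> = real (card {..<n}) * real n powr (\<delta> - 1)" by (simp add: powr_diff)
  also have "\<dots> \<le> (\<Sum>m<n. real (Suc m) powr (\<delta> - 1))"
    using assms by (intro sum_bounded_below powr_mono2') auto
  finally show ?thesis .
qed simp

section \<open>First return of the chain and of the walk\<close>

context hier_walk begin

definition returns :: "'w \<Rightarrow> bool" where
  "returns \<omega> \<longleftrightarrow> (\<exists>n\<ge>1. jump_chain N step origin n \<omega> = origin)"

definition first_return :: "'w \<Rightarrow> nat" where
  "first_return \<omega> = (LEAST n. n \<ge> 1 \<and> jump_chain N step origin n \<omega> = origin)"

text \<open>The first return happens at step n. The case n = 0 is excluded because returns count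
  from step 1 and n - 1 would be truncated.\<close>

definition hit :: "nat \<Rightarrow> 'w set" where
  "hit n = (if n = 0 then {} else visit n \<inter> avoid 0 (n - 1))"

definition never :: "'w set" where "never = (\<Inter>n. avoid 0 n)"

lemma first_return:
  assumes "returns \<omega>"
  shows "first_return \<omega> \<ge> 1" "jump_chain N step origin (first_return \<omega>) \<omega> = origin"
    and "\<And>n. n \<ge> 1 \<Longrightarrow> jump_chain N step origin n \<omega> = origin \<Longrightarrow> first_return \<omega> \<le> n"
proof -
  obtain n where "n \<ge> 1 \<and> jump_chain N step origin n \<omega> = origin" using assms by (auto simp: returns_def)
  then have "first_return \<omega> \<ge> 1 \<and> jump_chain N step origin (first_return \<omega>) \<omega> = origin"
    unfolding first_return_def by (rule LeastI)
  then show "first_return \<omega> \<ge> 1" "jump_chain N step origin (first_return \<omega>) \<omega> = origin" by auto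
  show "first_return \<omega> \<le> n" if "n \<ge> 1" "jump_chain N step origin n \<omega> = origin" for n
    unfolding first_return_def using that by (intro Least_le) auto
qed

text \<open>The premise \<open>returns \<omega>\<close> guards \<open>first_return\<close>, whose
  defining \<open>LEAST\<close> is unspecified on paths without a return.\<close>

lemma avoid_iff:
  assumes "\<omega> \<in> space M"
  shows "\<omega> \<in> avoid 0 n \<longleftrightarrow> (returns \<omega> \<longrightarrow> n < first_return \<omega>)"
proof
  assume a: "\<omega> \<in> avoid 0 n"
  show "returns \<omega> \<longrightarrow> n < first_return \<omega>"
  proof (rule impI, rule ccontr)
    assume r: "returns \<omega>" and "\<not> n < first_return \<omega>"
    then have "first_return \<omega> \<in> {1..n}" using first_return(1)[OF r] by auto
    then show False using a first_return(2)[OF r] by (simp add: avoid_0)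
  qed
next
  assume a: "returns \<omega> \<longrightarrow> n < first_return \<omega>"
  have "jump_chain N step origin i \<omega> \<noteq> origin" if "i \<in> {1..n}" for i
  proof
    assume i: "jump_chain N step origin i \<omega> = origin"
    then have r: "returns \<omega>" using that by (auto simp: returns_def)
    then have "first_return \<omega> \<le> i" using that i by (intro first_return(3)) auto
    then show False using a r that by auto
  qed
  then show "\<omega> \<in> avoid 0 n" using assms by (simp add: avoid_0)
qed

lemma hit_iff:
  assumes "\<omega> \<in> space M"
  shows "\<omega> \<in> hit n \<longleftrightarrow> returns \<omega> \<and> n = first_return \<omega>"
proof
  assume "\<omega> \<in> hit n"
  then have n: "n \<ge> 1" "jump_chain N step origin n \<omega> = origin" and a: "\<omega> \<in> avoid 0 (n - 1)"
    by (auto simp: hit_def visit_def split: if_splits)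
  then have r: "returns \<omega>" by (auto simp: returns_def)
  then show "returns \<omega> \<and> n = first_return \<omega>"
    using first_return(3)[OF r n] a avoid_iff[OF assms, of "n - 1"] n(1) by auto
next
  assume "returns \<omega> \<and> n = first_return \<omega>"
  then show "\<omega> \<in> hit n"
    using first_return[of \<omega>] assms avoid_iff[OF assms, of "n - 1"] by (auto simp: hit_def visit_def)
qed

lemma never_iff: "\<omega> \<in> space M \<Longrightarrow> \<omega> \<in> never \<longleftrightarrow> \<not> returns \<omega>"
  by (auto simp: never_def avoid_iff)

lemma hit_sets: "hit n \<in> sets (step_algebra UNIV)" "hit n \<in> events"
proof -
  have mono: "sets (step_algebra J) \<subseteq> sets (step_algebra UNIV)" for J
    unfolding sets_algebras by (intro sigma_sets_mono') auto
  have "visit n \<inter> avoid 0 (n - 1) \<in> sets (step_algebra UNIV)"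
    using visit_sets(1) avoid_sets(1) mono by (intro sets.Int) (blast+)
  then show "hit n \<in> sets (step_algebra UNIV)" by (simp add: hit_def)
  then show "hit n \<in> events" using sets_algebras_subset by blast
qed

lemma never_sets: "never \<in> events"
  unfolding never_def by (intro sets.countable_INT') (auto simp: avoid_sets)

lemma AE_step_neq_origin: "AE \<omega> in M. step 0 \<omega> \<noteq> origin"
proof -
  have ev: "{\<omega> \<in> space M. step 0 \<omega> = origin} \<in> events"
    by (rule sets_jump_chain_eq[OF step_measurable]) auto
  have "prob {\<omega> \<in> space M. step 0 \<omega> = origin} = 0"
    using step_distribution[of origin 0] by (simp add: step_prob_def)
  then have "AE \<omega> in M. \<omega> \<notin> {\<omega> \<in> space M. step 0 \<omega> = origin}"
    using ev by (simp add: prob_eq_0)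
  then show ?thesis by (rule AE_mp) (auto intro!: AE_I2)
qed

lemma exit_time_eq:
  assumes "regular \<omega>" "\<omega> \<in> space M" "step 0 \<omega> \<noteq> origin"
  shows "exit_time (walk N hold step origin) origin \<omega> = ennreal (arrival 1 \<omega>)"
  unfolding exit_time_def
proof (rule antisym)
  have pos: "0 < arrival 1 \<omega>" using assms(1) by (auto simp: arrival_def regular_def)
  have "jump_count hold (arrival 1 \<omega>) \<omega> = 1"
    using regular_arrival_less_iff[OF assms(1)] pos by (subst regular_jump_count_iff[OF assms(1)]) auto
  then have "walk N hold step origin (arrival 1 \<omega>) \<omega> \<noteq> origin"
    using assms(2,3) step_in by (simp add: walk_def)
  then show "(INF t\<in>{t. 0 < t \<and> walk N hold step origin t \<omega> \<noteq> origin}. ennreal t) \<le> ennreal (arrival 1 \<omega>)"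
    using pos by (intro INF_lower) auto
  show "ennreal (arrival 1 \<omega>) \<le> (INF t\<in>{t. 0 < t \<and> walk N hold step origin t \<omega> \<noteq> origin}. ennreal t)"
  proof (rule INF_greatest)
    fix t assume t: "t \<in> {t. 0 < t \<and> walk N hold step origin t \<omega> \<noteq> origin}"
    have "arrival 1 \<omega> \<le> t"
    proof (rule ccontr)
      assume "\<not> arrival 1 \<omega> \<le> t"
      then have "jump_count hold t \<omega> = 0"
        using t by (subst regular_jump_count_iff[OF assms(1)]) (auto simp: arrival_def)
      then show False using t by (simp add: walk_def)
    qed
    then show "ennreal (arrival 1 \<omega>) \<le> ennreal t" by (rule ennreal_leI)
  qed
qed

text \<open>The infimum is attained at the jump that brings the chain back. As the first step is not
  the identity, the return index exceeds 1, so this jump comes strictly after the exit time.\<close>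

lemma return_time_eq:
  assumes "regular \<omega>" "\<omega> \<in> space M" "step 0 \<omega> \<noteq> origin"
  shows "return_time (walk N hold step origin) origin \<omega> =
    (if returns \<omega> then ennreal (arrival (first_return \<omega>) \<omega>) else \<infinity>)"
proof -
  note less = regular_arrival_less_iff[OF assms(1)]
  have pos: "0 < arrival 1 \<omega>" using assms(1) by (auto simp: arrival_def regular_def)
  let ?T = "{t. exit_time (walk N hold step origin) origin \<omega> < ennreal t \<and> walk N hold step origin t \<omega> = origin}"
  \<comment> \<open>A time after the exit at which the walk is at the origin lies in the holding
    interval of some visit with index at least 1.\<close>
  have mem: "\<exists>n\<ge>1. arrival n \<omega> \<le> t \<and> jump_chain N step origin n \<omega> = origin" if "t \<in> ?T" for t
  proof -
    have "arrival 1 \<omega> < t" using that pos by (simp add: exit_time_eq[OF assms] ennreal_less_iff)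
    moreover define n where "n = jump_count hold t \<omega>"
    ultimately have "arrival n \<omega> \<le> t" "t < arrival (Suc n) \<omega>"
      using regular_jump_count_iff[OF assms(1), of t n] pos by auto
    moreover from this \<open>arrival 1 \<omega> < t\<close> have "arrival 1 \<omega> < arrival (Suc n) \<omega>" by linarith
    then have "n \<ge> 1" using less by simp
    moreover have "jump_chain N step origin n \<omega> = origin" using that by (simp add: walk_def n_def)
    ultimately show ?thesis by blast
  qed
  show ?thesis
  proof (cases "returns \<omega>")
    case True
    let ?n = "first_return \<omega>"
    have "?n \<noteq> 1"
    proof
      assume "?n = 1"
      then show False using first_return(2)[OF True] assms(2,3) step_in by simp
    qed
    then have n: "1 < ?n" using first_return(1)[OF True] by simp
    have a: "arrival 1 \<omega> < arrival ?n \<omega>" using less n by blast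
    then have "0 < arrival ?n \<omega>" using pos by linarith
    then have "jump_count hold (arrival ?n \<omega>) \<omega> = ?n"
      using less by (subst regular_jump_count_iff[OF assms(1) less_imp_le]) auto
    then have "arrival ?n \<omega> \<in> ?T"
      using a pos first_return(2)[OF True] by (simp add: exit_time_eq[OF assms] ennreal_less_iff walk_def)
    then have "return_time (walk N hold step origin) origin \<omega> \<le> ennreal (arrival ?n \<omega>)"
      unfolding return_time_def by (intro INF_lower) auto
    moreover have "ennreal (arrival ?n \<omega>) \<le> return_time (walk N hold step origin) origin \<omega>"
      unfolding return_time_def
    proof (rule INF_greatest)
      fix t assume "t \<in> ?T"
      then obtain n where "n \<ge> 1" "arrival n \<omega> \<le> t" "jump_chain N step origin n \<omega> = origin"
        using mem by blast
      moreover from this have "arrival ?n \<omega> \<le> arrival n \<omega>" using first_return(3)[OF True] less(2) by blast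
      ultimately show "ennreal (arrival ?n \<omega>) \<le> ennreal t" by (intro ennreal_leI) linarith
    qed
    ultimately show ?thesis using True by simp
  next
    case False
    then have empty: "?T = {}" using mem by (auto simp: returns_def)
    show ?thesis using False unfolding return_time_def empty by simp
  qed
qed

lemma arrival_nonneg: "regular \<omega> \<Longrightarrow> 0 \<le> arrival n \<omega>"
  unfolding arrival_def by (rule sum_nonneg) (auto simp: regular_def less_imp_le)

lemma moment_return_time:
  "moment M (return_time (walk N hold step origin) origin) \<delta> =
    (\<integral>\<^sup>+\<omega>. (if returns \<omega> then ennreal (arrival (first_return \<omega>) \<omega> powr \<delta>) else \<infinity>) \<partial>M)"
  unfolding moment_def
proof (rule nn_integral_cong_AE)
  show "AE \<omega> in M.
    (if return_time (walk N hold step origin) origin \<omega> = \<infinity> then \<infinity>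
     else ennreal (enn2real (return_time (walk N hold step origin) origin \<omega>) powr \<delta>)) =
    (if returns \<omega> then ennreal (arrival (first_return \<omega>) \<omega> powr \<delta>) else \<infinity>)"
    using AE_regular AE_step_neq_origin AE_space
    by eventually_elim (simp add: return_time_eq arrival_nonneg)
qed

lemma nn_integral_mult_indicator_indep:
  fixes Y :: "'w \<Rightarrow> ennreal"
  assumes Y: "Y \<in> borel_measurable hold_algebra" and E: "E \<in> sets (step_algebra UNIV)"
  shows "(\<integral>\<^sup>+\<omega>. Y \<omega> * indicator E \<omega> \<partial>M) = (\<integral>\<^sup>+\<omega>. Y \<omega> \<partial>M) * emeasure M E"
proof -
  have "indep_var borel Y borel (indicator E :: _ \<Rightarrow> ennreal)"
    by (rule indep_var_of_indep_set[OF indep_hold_step_algebra]) (use Y E in auto)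
  moreover have "case_bool borel borel = (\<lambda>_. borel :: ennreal measure)" by (auto split: bool.split)
  ultimately have "indep_vars (\<lambda>_. borel) (case_bool Y (indicator E :: _ \<Rightarrow> ennreal)) UNIV"
    unfolding indep_var_def by simp
  from indep_vars_nn_integral[OF _ this] show ?thesis
    using E sets_algebras_subset(2)[of UNIV] by (simp add: UNIV_bool mult.commute subset_iff)
qed

text \<open>Split by the step of the first return. \<open>hit n\<close> depends on the steps alone
  and \<open>Y n\<close> on the holding times alone, so each term factorises; the paths without a
  return contribute separately.\<close>

lemma nn_integral_first_return:
  fixes Y :: "nat \<Rightarrow> 'w \<Rightarrow> ennreal"
  assumes Y: "\<And>n. Y n \<in> borel_measurable hold_algebra"
  shows "(\<integral>\<^sup>+\<omega>. (if returns \<omega> then Y (first_return \<omega>) \<omega> else \<infinity>) \<partial>M) =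
    (\<Sum>n. (\<integral>\<^sup>+\<omega>. Y n \<omega> \<partial>M) * emeasure M (hit n)) + \<infinity> * emeasure M never"
proof -
  have YM: "Y n \<in> borel_measurable M" for n
    using measurable_mono[of borel borel hold_algebra M] sets_algebras_subset(1) Y by auto
  have "(if returns \<omega> then Y (first_return \<omega>) \<omega> else \<infinity>) =
      (\<Sum>n. Y n \<omega> * indicator (hit n) \<omega>) + \<infinity> * indicator never \<omega>" if "\<omega> \<in> space M" for \<omega>
  proof -
    have "(\<Sum>n. Y n \<omega> * indicator (hit n) \<omega>) = (\<Sum>n\<in>(if returns \<omega> then {first_return \<omega>} else {}). Y n \<omega> * indicator (hit n) \<omega>)"
      using that by (intro suminf_finite) (auto simp: hit_iff indicator_def split: if_splits)
    then show ?thesis using that by (simp add: hit_iff never_iff indicator_def)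
  qed
  then have "(\<integral>\<^sup>+\<omega>. (if returns \<omega> then Y (first_return \<omega>) \<omega> else \<infinity>) \<partial>M) =
      (\<integral>\<^sup>+\<omega>. (\<Sum>n. Y n \<omega> * indicator (hit n) \<omega>) + \<infinity> * indicator never \<omega> \<partial>M)"
    by (intro nn_integral_cong)
  also have "\<dots> = (\<integral>\<^sup>+\<omega>. (\<Sum>n. Y n \<omega> * indicator (hit n) \<omega>) \<partial>M) + (\<integral>\<^sup>+\<omega>. \<infinity> * indicator never \<omega> \<partial>M)"
    using YM hit_sets never_sets by (intro nn_integral_add) auto
  also have "(\<integral>\<^sup>+\<omega>. (\<Sum>n. Y n \<omega> * indicator (hit n) \<omega>) \<partial>M) = (\<Sum>n. \<integral>\<^sup>+\<omega>. Y n \<omega> * indicator (hit n) \<omega> \<partial>M)"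
    using YM hit_sets by (intro nn_integral_suminf) auto
  also have "\<dots> = (\<Sum>n. (\<integral>\<^sup>+\<omega>. Y n \<omega> \<partial>M) * emeasure M (hit n))"
    using Y hit_sets(1) by (intro suminf_cong nn_integral_mult_indicator_indep)
  also have "(\<integral>\<^sup>+\<omega>. \<infinity> * indicator never \<omega> \<partial>M) = \<infinity> * emeasure M never"
    using never_sets by (rule nn_integral_cmult_indicator)
  finally show ?thesis .
qed

section \<open>Replacing jump times by their indices\<close>

lemma nn_integral_hold: "(\<integral>\<^sup>+\<omega>. ennreal (hold k \<omega>) \<partial>M) = 1"
proof -
  have "(\<integral>\<^sup>+\<omega>. ennreal (hold k \<omega>) \<partial>M) = (\<integral>\<^sup>+x. ennreal (exponential_density 1 x) * ennreal x \<partial>lborel)"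
    by (rule distributed_nn_integral[OF hold_distributed, symmetric]) simp
  also have "\<dots> = (\<integral>\<^sup>+x. ennreal (erlang_density 0 1 x * x ^ 1) \<partial>lborel)"
    by (intro nn_integral_cong) (simp add: ennreal_mult'[symmetric])
  also have "\<dots> = 1" by (subst nn_integral_erlang_ith_moment) auto
  finally show ?thesis .
qed

lemma nn_integral_arrival: "(\<integral>\<^sup>+\<omega>. ennreal (arrival n \<omega>) \<partial>M) = ennreal (real n)"
proof -
  have "(\<integral>\<^sup>+\<omega>. ennreal (arrival n \<omega>) \<partial>M) = (\<integral>\<^sup>+\<omega>. (\<Sum>k<n. ennreal (hold k \<omega>)) \<partial>M)"
    by (rule nn_integral_cong_AE, use AE_regular in eventually_elim)
       (auto simp: arrival_def regular_def less_imp_le)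
  also have "\<dots> = (\<Sum>k<n. \<integral>\<^sup>+\<omega>. ennreal (hold k \<omega>) \<partial>M)"
    using hold_borel by (intro nn_integral_sum) simp
  finally show ?thesis by (simp add: nn_integral_hold ennreal_of_nat_eq_real_of_nat)
qed

lemma nn_integral_arrival_powr_le:
  assumes "0 < \<delta>" "\<delta> \<le> 1" "n \<ge> 1"
  shows "(\<integral>\<^sup>+\<omega>. ennreal (arrival n \<omega> powr \<delta>) \<partial>M) \<le> ennreal (2 * real n powr \<delta>)"
proof -
  have "(\<integral>\<^sup>+\<omega>. ennreal (arrival n \<omega> powr \<delta>) \<partial>M) \<le>
      (\<integral>\<^sup>+\<omega>. ennreal (real n powr \<delta>) + ennreal (real n powr (\<delta> - 1)) * ennreal (arrival n \<omega>) \<partial>M)"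
  proof (rule nn_integral_mono_AE)
    show "AE \<omega> in M. ennreal (arrival n \<omega> powr \<delta>) \<le>
        ennreal (real n powr \<delta>) + ennreal (real n powr (\<delta> - 1)) * ennreal (arrival n \<omega>)"
      using AE_regular
    proof eventually_elim
      case (elim \<omega>)
      have "arrival n \<omega> powr \<delta> \<le> real n powr \<delta> + real n powr (\<delta> - 1) * arrival n \<omega>"
        using assms arrival_nonneg[OF elim] by (intro powr_le_tangent) auto
      then have "ennreal (arrival n \<omega> powr \<delta>) \<le> ennreal (real n powr \<delta> + real n powr (\<delta> - 1) * arrival n \<omega>)"
        by (rule ennreal_leI)
      then show ?case using arrival_nonneg[OF elim] by (simp add: ennreal_plus ennreal_mult)
    qed
  qed
  also have "\<dots> = ennreal (real n powr \<delta>) + ennreal (real n powr (\<delta> - 1)) * ennreal (real n)"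
    using arrival_borel[of n]
    by (subst nn_integral_add, simp, simp, subst nn_integral_cmult) (simp_all add: nn_integral_arrival emeasure_space_1)
  also have "\<dots> = ennreal (real n powr \<delta> + real n powr (\<delta> - 1) * real n)"
    by (simp add: ennreal_plus ennreal_mult)
  also have "real n powr \<delta> + real n powr (\<delta> - 1) * real n = 2 * real n powr \<delta>"
    using assms by (simp add: powr_diff)
  finally show ?thesis .
qed

text \<open>The n-th jump time is at least the number of the first n holding times that exceed 1,
  each of which does so with probability exp (-1). The chord bound is linear in this number, so only
  its mean enters.\<close>

lemma nn_integral_arrival_powr_ge:
  assumes "0 < \<delta>" "n \<ge> 1"
  shows "ennreal (exp (-1) * real n powr min \<delta> 1) \<le> (\<integral>\<^sup>+\<omega>. ennreal (arrival n \<omega> powr \<delta>) \<partial>M)"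
proof -
  let ?A = "\<lambda>k. {\<omega> \<in> space M. 1 < hold k \<omega>}"
  have A: "?A k \<in> events" for k using hold_borel[of k] by measurable
  have "(\<integral>\<^sup>+\<omega>. ennreal (real n powr (min \<delta> 1 - 1)) * (\<Sum>k<n. indicator (?A k) \<omega>) \<partial>M) \<le>
      (\<integral>\<^sup>+\<omega>. ennreal (arrival n \<omega> powr \<delta>) \<partial>M)"
  proof (rule nn_integral_mono_AE)
    show "AE \<omega> in M. ennreal (real n powr (min \<delta> 1 - 1)) * (\<Sum>k<n. indicator (?A k) \<omega>) \<le> ennreal (arrival n \<omega> powr \<delta>)"
      using AE_regular
    proof eventually_elim
      case (elim \<omega>)
      define m where "m = card {k\<in>{..<n}. \<omega> \<in> ?A k}"
      have "real m = (\<Sum>k<n. indicat_real (?A k) \<omega>)"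
        unfolding m_def by (simp add: indicator_def sum.If_cases Int_def)
      also have "\<dots> \<le> arrival n \<omega>"
        unfolding arrival_def using elim by (intro sum_mono) (auto simp: indicator_def regular_def less_imp_le)
      finally have "real m \<le> arrival n \<omega>" .
      moreover have "m \<le> n" unfolding m_def using card_mono[of "{..<n}" "{k\<in>{..<n}. \<omega> \<in> ?A k}"] by auto
      ultimately have "real n powr (min \<delta> 1 - 1) * real m \<le> arrival n \<omega> powr \<delta>"
        using assms by (intro powr_ge_chord)
      then have "ennreal (real n powr (min \<delta> 1 - 1) * real m) \<le> ennreal (arrival n \<omega> powr \<delta>)"
        by (rule ennreal_leI)
      moreover have "(\<Sum>k<n. indicator (?A k) \<omega>) = ennreal (real m)"
        unfolding m_def by (simp add: indicator_def sum.If_cases Int_def ennreal_of_nat_eq_real_of_nat)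
      ultimately show ?case by (simp add: ennreal_mult)
    qed
  qed
  moreover have "(\<integral>\<^sup>+\<omega>. ennreal (real n powr (min \<delta> 1 - 1)) * (\<Sum>k<n. indicator (?A k) \<omega>) \<partial>M) =
      ennreal (real n powr (min \<delta> 1 - 1)) * (\<Sum>k<n. emeasure M (?A k))"
    using A by (subst nn_integral_cmult, simp, subst nn_integral_sum) auto
  moreover have "emeasure M (?A k) = ennreal (exp (-1))" for k
    using exponential_distributedD_gt[OF hold_distributed, of 1 k] by (simp add: emeasure_eq_measure)
  moreover have "ennreal (real n powr (min \<delta> 1 - 1)) * (of_nat n * ennreal (exp (-1))) =
      ennreal (exp (-1) * real n powr min \<delta> 1)"
    using assms by (simp add: ennreal_of_nat_eq_real_of_nat ennreal_mult[symmetric] powr_diff)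
  ultimately show ?thesis by simp
qed

text \<open>After conditioning on the return index the comparison is made term by term; the term n =
  0 vanishes because \<open>hit 0\<close> is empty, and the \<open>never\<close> terms
  agree.\<close>

lemma moment_le_first_return:
  assumes "0 < \<delta>" "\<delta> \<le> 1"
  shows "moment M (return_time (walk N hold step origin) origin) \<delta> \<le>
    (\<integral>\<^sup>+\<omega>. (if returns \<omega> then ennreal (2 * real (first_return \<omega>) powr \<delta>) else \<infinity>) \<partial>M)"
proof -
  have "(\<integral>\<^sup>+\<omega>. ennreal (arrival n \<omega> powr \<delta>) \<partial>M) * emeasure M (hit n) \<le>
      (\<integral>\<^sup>+\<omega>. ennreal (2 * real n powr \<delta>) \<partial>M) * emeasure M (hit n)" for n
    using nn_integral_arrival_powr_le[OF assms, of n]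
    by (cases "n = 0") (auto simp: hit_def emeasure_space_1 intro!: mult_right_mono)
  then show ?thesis
    unfolding moment_return_time using arrival_measurable
    by (subst (1 2) nn_integral_first_return) (auto intro!: add_right_mono suminf_le)
qed

lemma moment_ge_first_return:
  assumes "0 < \<delta>"
  shows "(\<integral>\<^sup>+\<omega>. (if returns \<omega> then ennreal (exp (-1) * real (first_return \<omega>) powr min \<delta> 1) else \<infinity>) \<partial>M) \<le>
    moment M (return_time (walk N hold step origin) origin) \<delta>"
proof -
  have "(\<integral>\<^sup>+\<omega>. ennreal (exp (-1) * real n powr min \<delta> 1) \<partial>M) * emeasure M (hit n) \<le>
      (\<integral>\<^sup>+\<omega>. ennreal (arrival n \<omega> powr \<delta>) \<partial>M) * emeasure M (hit n)" for n
    using nn_integral_arrival_powr_ge[OF assms, of n]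
    by (cases "n = 0") (auto simp: hit_def emeasure_space_1 intro!: mult_right_mono)
  then show ?thesis
    unfolding moment_return_time using arrival_measurable
    by (subst (1 2) nn_integral_first_return) (auto intro!: add_right_mono suminf_le)
qed

text \<open>The power \<delta> of the first return is at most the sum of (m + 1) to the power
  \<delta> - 1 over all m with no return up to m. Taking expectations leaves a series with exponent
  \<delta> - 1 - \<beta> < -1.\<close>

lemma moment_return_time_finite:
  assumes \<delta>: "0 < \<delta>" "\<delta> < \<beta>" "\<delta> \<le> 1" and q: "\<And>n. prob (avoid 0 n) \<le> C * real (Suc n) powr - \<beta>"
  shows "moment M (return_time (walk N hold step origin) origin) \<delta> < \<infinity>"
proof -
  \<comment> \<open>The decay of the avoidance probabilities forces the walk to return almost
    surely, which disposes of the infinite value.\<close>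
  have "(\<lambda>n. C * real (Suc n) powr - \<beta>) \<longlonglongrightarrow> C * 0"
    using \<delta> by (intro tendsto_intros tendsto_neg_powr filterlim_compose[OF filterlim_real_sequentially] filterlim_Suc) auto
  moreover have "prob never \<le> C * real (Suc n) powr - \<beta>" for n
    using finite_measure_mono[of never "avoid 0 n"] q[of n] avoid_sets by (force simp: never_def)
  ultimately have "prob never \<le> C * 0" by (intro LIMSEQ_le_const) auto
  then have "prob never = 0" using measure_nonneg[of M never] by simp
  then have never: "AE \<omega> in M. \<omega> \<notin> never" using never_sets by (simp add: prob_eq_0)
  let ?a = "\<lambda>m. 2 * real (Suc m) powr (\<delta> - 1)"
  have "(\<integral>\<^sup>+\<omega>. (if returns \<omega> then ennreal (2 * real (first_return \<omega>) powr \<delta>) else \<infinity>) \<partial>M) \<le>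
      (\<integral>\<^sup>+\<omega>. (\<Sum>m. ennreal (?a m) * indicator (avoid 0 m) \<omega>) \<partial>M)"
  proof (rule nn_integral_mono_AE)
    show "AE \<omega> in M. (if returns \<omega> then ennreal (2 * real (first_return \<omega>) powr \<delta>) else \<infinity>) \<le>
        (\<Sum>m. ennreal (?a m) * indicator (avoid 0 m) \<omega>)"
      using never AE_space
    proof eventually_elim
      case (elim \<omega>)
      then have r: "returns \<omega>" by (simp add: never_iff)
      have "2 * real (first_return \<omega>) powr \<delta> \<le> (\<Sum>m<first_return \<omega>. ?a m)"
        using powr_le_sum_powr[of \<delta> "first_return \<omega>"] \<delta> by (simp add: sum_distrib_left[symmetric])
      then have "ennreal (2 * real (first_return \<omega>) powr \<delta>) \<le> ennreal (\<Sum>m<first_return \<omega>. ?a m)"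
        by (rule ennreal_leI)
      also have "\<dots> = (\<Sum>m<first_return \<omega>. ennreal (?a m) * indicator (avoid 0 m) \<omega>)"
        using elim by (simp add: avoid_iff)
      also have "\<dots> \<le> (\<Sum>m. ennreal (?a m) * indicator (avoid 0 m) \<omega>)"
        by (intro sum_le_suminf) auto
      finally show ?case using r by simp
    qed
  qed
  also have "\<dots> = (\<Sum>m. ennreal (?a m) * ennreal (prob (avoid 0 m)))"
    using avoid_sets by (subst nn_integral_suminf) (auto simp: nn_integral_cmult_indicator emeasure_eq_measure)
  also have "\<dots> = (\<Sum>m. ennreal (?a m * prob (avoid 0 m)))"
    by (simp add: ennreal_mult[symmetric])
  also have "\<dots> < \<infinity>"
  proof -
    have "summable (\<lambda>m. ?a m * prob (avoid 0 m))"
    proof (rule summable_comparison_test')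
      have "summable (\<lambda>m. real (Suc m) powr (\<delta> - 1 - \<beta>))"
        using \<delta> summable_iff_shift[of "\<lambda>m. real m powr (\<delta> - 1 - \<beta>)" 1] by (simp add: summable_real_powr_iff)
      then show "summable (\<lambda>m. 2 * C * real (Suc m) powr (\<delta> - 1 - \<beta>))" by (rule summable_mult)
      fix m
      have "?a m * prob (avoid 0 m) \<le> ?a m * (C * real (Suc m) powr - \<beta>)"
        by (intro mult_left_mono q) simp
      also have "\<dots> = 2 * C * (real (Suc m) powr (\<delta> - 1) * real (Suc m) powr - \<beta>)" by simp
      also have "real (Suc m) powr (\<delta> - 1) * real (Suc m) powr - \<beta> = real (Suc m) powr (\<delta> - 1 - \<beta>)"
        by (simp only: powr_add[symmetric]) simp
      finally show "norm (?a m * prob (avoid 0 m)) \<le> 2 * C * real (Suc m) powr (\<delta> - 1 - \<beta>)" by simp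
    qed
    then show ?thesis by (subst suminf_ennreal_finite_iff) auto
  qed
  finally show ?thesis using moment_le_first_return[OF \<delta>(1,3)] by (rule le_less_trans[rotated])
qed

text \<open>The number of n \<le> m without a return up to n is at most the return index and at most
  m + 1. Interpolation with exponent \<open>min \<delta> 1\<close>, which must not exceed 1, brings
  in the moment.\<close>

lemma sum_prob_avoid_le_moment:
  assumes \<delta>: "0 < \<delta>" and fin: "moment M (return_time (walk N hold step origin) origin) \<delta> < \<infinity>"
  shows "\<exists>C. \<forall>m. (\<Sum>n\<le>m. prob (avoid 0 n)) \<le> C * real (Suc m) powr (1 - min \<delta> 1)"
proof -
  let ?d = "min \<delta> 1"
  let ?W = "\<lambda>\<omega>. if returns \<omega> then ennreal (exp (-1) * real (first_return \<omega>) powr ?d) else \<infinity>"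
  define I where "I = (\<integral>\<^sup>+\<omega>. ?W \<omega> \<partial>M)"
  have I: "I < \<infinity>" unfolding I_def using moment_ge_first_return[OF \<delta>] fin by (rule le_less_trans)
  \<comment> \<open>Measurability is read off from a series over the disjoint events
    \<open>hit n\<close> that agrees with \<open>?W\<close> on the space.\<close>
  have W: "?W \<in> borel_measurable M"
  proof (rule measurable_cong[THEN iffD1])
    fix \<omega> assume \<omega>: "\<omega> \<in> space M"
    have "(\<Sum>n. ennreal (exp (-1) * real n powr ?d) * indicator (hit n) \<omega>) =
        (\<Sum>n\<in>(if returns \<omega> then {first_return \<omega>} else {}). ennreal (exp (-1) * real n powr ?d) * indicator (hit n) \<omega>)"
      using \<omega> by (intro suminf_finite) (auto simp: hit_iff indicator_def split: if_splits)
    then show "(\<Sum>n. ennreal (exp (-1) * real n powr ?d) * indicator (hit n) \<omega>) + \<infinity> * indicator never \<omega> = ?W \<omega>"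
      using \<omega> by (simp add: hit_iff never_iff indicator_def)
  next
    show "(\<lambda>\<omega>. (\<Sum>n. ennreal (exp (-1) * real n powr ?d) * indicator (hit n) \<omega>) + \<infinity> * indicator never \<omega>) \<in> borel_measurable M"
      using hit_sets never_sets by measurable
  qed
  have "(\<Sum>n\<le>m. prob (avoid 0 n)) \<le> (exp 1 * enn2real I) * real (Suc m) powr (1 - ?d)" for m
  proof -
    have "(\<Sum>n\<le>m. ennreal (prob (avoid 0 n))) = (\<integral>\<^sup>+\<omega>. (\<Sum>n\<le>m. indicator (avoid 0 n) \<omega>) \<partial>M)"
      using avoid_sets by (subst nn_integral_sum) (auto simp: emeasure_eq_measure)
    also have "\<dots> \<le> (\<integral>\<^sup>+\<omega>. ennreal (exp 1 * real (Suc m) powr (1 - ?d)) * ?W \<omega> \<partial>M)"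
    proof (rule nn_integral_mono)
      fix \<omega> assume \<omega>: "\<omega> \<in> space M"
      show "(\<Sum>n\<le>m. indicator (avoid 0 n) \<omega>) \<le> ennreal (exp 1 * real (Suc m) powr (1 - ?d)) * ?W \<omega>"
      proof (cases "returns \<omega>")
        case True
        define z where "z = card {n\<in>{..m}. n < first_return \<omega>}"
        have "(\<Sum>n\<le>m. indicator (avoid 0 n) \<omega> :: ennreal) = ennreal (real z)"
          using \<omega> True unfolding z_def
          by (simp add: indicator_def avoid_iff sum.If_cases Int_def ennreal_of_nat_eq_real_of_nat)
        also have "\<dots> \<le> ennreal (real (first_return \<omega>) powr ?d * real (Suc m) powr (1 - ?d))"
        proof (intro ennreal_leI min_le_powr_mult_powr)
          have "z \<le> card {..m}" "z \<le> card {..<first_return \<omega>}"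
            unfolding z_def by (rule card_mono; force)+
          then show "real z \<le> real (first_return \<omega>)" "real z \<le> real (Suc m)" by auto
        qed (use \<delta> in auto)
        also have "\<dots> = ennreal (exp 1 * real (Suc m) powr (1 - ?d) * (exp (-1) * real (first_return \<omega>) powr ?d))"
          by (simp add: exp_minus)
        finally show ?thesis using True by (simp add: ennreal_mult)
      next
        case False
        then show ?thesis by (simp add: ennreal_mult_eq_top_iff)
      qed
    qed
    also have "\<dots> = ennreal (exp 1 * real (Suc m) powr (1 - ?d)) * I"
      unfolding I_def by (rule nn_integral_cmult[OF W])
    also have "I = ennreal (enn2real I)" using I by simp
    finally have "ennreal (\<Sum>n\<le>m. prob (avoid 0 n)) \<le> ennreal (exp 1 * real (Suc m) powr (1 - ?d) * enn2real I)"
      by (simp add: ennreal_mult)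
    then show ?thesis by (subst (asm) ennreal_le_iff) (auto simp: mult_ac)
  qed
  then show ?thesis by blast
qed

end

section \<open>Walks with asymptotically geometric rates\<close>

lemma powr_Suc_unbounded:
  fixes C \<epsilon> :: real
  assumes "\<epsilon> > 0"
  shows "\<exists>m. C < real (Suc m) powr \<epsilon>"
proof -
  obtain m where m: "max C 1 powr (1 / \<epsilon>) < real m" using reals_Archimedean2 by blast
  have "C \<le> (max C 1 powr (1 / \<epsilon>)) powr \<epsilon>" using assms by (simp add: powr_powr)
  also have "\<dots> < real (Suc m) powr \<epsilon>" using m assms by (intro powr_less_mono2) auto
  finally show ?thesis by blast
qed

text \<open>The normalising constant is abstracted to a positive \<open>D\<close>, and only the
  index-shifted form of the rates is recorded.\<close>

locale mu_c_walk = hier_walk M N r hold step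
  for M :: "'w measure" and N :: nat and r :: "nat \<Rightarrow> real"
    and hold :: "nat \<Rightarrow> 'w \<Rightarrow> real" and step :: "nat \<Rightarrow> 'w \<Rightarrow> nat \<Rightarrow> int" +
  fixes \<mu> D :: real and c :: "nat \<Rightarrow> real"
  assumes \<mu>_pos: "\<mu> > 0" and D_pos: "D > 0" and c_pos: "\<And>j. c j > 0"
    and c_ratio: "(\<lambda>j. c (Suc j) / c j) \<longlonglongrightarrow> 1"
    and rate: "\<And>k. r (Suc k) = D * c k * real N powr (- real k / \<mu>)"
begin

text \<open>The limit of the ratio of consecutive rates. Its power \<mu> is 1 / N, which is what
  makes \<mu> the critical exponent.\<close>

definition L :: real where "L = real N powr (- 1 / \<mu>)"

lemma L: "0 < L" "L < 1"
proof -
  show "0 < L" using N2 by (simp add: L_def)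
  show "L < 1" using N2 \<mu>_pos by (simp add: L_def powr_less_one)
qed

lemma L_powr: "L powr s = real N powr (- s / \<mu>)"
  by (simp add: L_def powr_powr)

lemma rate_ratio: "(\<lambda>k. r (Suc (Suc k)) / r (Suc k)) \<longlonglongrightarrow> L"
proof -
  have "r (Suc (Suc k)) / r (Suc k) = (c (Suc k) / c k) * L" for k
  proof -
    have "real N powr (- real (Suc k) / \<mu>) = real N powr (- real k / \<mu>) * L"
    proof -
      have "- real (Suc k) / \<mu> = - real k / \<mu> + - 1 / \<mu>" using \<mu>_pos by (simp add: field_simps)
      then show ?thesis by (simp only: L_def powr_add)
    qed
    then show ?thesis using D_pos N2 by (simp add: rate)
  qed
  moreover have "(\<lambda>k. (c (Suc k) / c k) * L) \<longlonglongrightarrow> 1 * L" by (intro tendsto_intros c_ratio)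
  ultimately show ?thesis by simp
qed

lemma rate_pos: "r (Suc k) > 0" using r_pos[of "Suc k"] by simp

text \<open>Together with the first bound in \<open>eigval_bounds\<close> this compares
  \<open>1 - eigval k\<close> with \<open>r (Suc k)\<close> from both sides.\<close>

lemma one_minus_eigval_comparable: "\<exists>A>0. \<forall>k. 1 - eigval k \<le> A * r (Suc k)"
proof -
  obtain A where A: "A > 0" "\<And>k. (\<Sum>j. r (Suc (j + k))) \<le> A * r (Suc k)"
    using tail_sum_le_ratio[OF rate_pos rate_ratio L(2)] by auto
  have "1 - eigval k \<le> (2 * A) * r (Suc k)" for k
    using eigval_bounds(2)[of k] A(2)[of k] by linarith
  with A(1) show ?thesis by (intro exI[of _ "2 * A"]) auto
qed

lemma summable_weight_iff:
  assumes "s > 0"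
  shows "summable (\<lambda>k. weight k * (1 - eigval k) powr - s) \<longleftrightarrow> summable (\<lambda>k. (1 / real N) ^ k * r (Suc k) powr - s)"
proof -
  obtain A where A: "A > 0" "\<And>k. 1 - eigval k \<le> A * r (Suc k)" using one_minus_eigval_comparable by blast
  have w: "weight k = (real N - 1) / real N * (1 / real N) ^ k" for k
    using N2 by (simp add: weight_def power_divide)
  have "(1 - eigval k) powr - s \<le> r (Suc k) powr - s" for k
    using eigval_bounds(1)[of k] rate_pos[of k] assms by (intro powr_mono2') auto
  then have 1: "norm (weight k * (1 - eigval k) powr - s) \<le>
      (real N - 1) / real N * ((1 / real N) ^ k * r (Suc k) powr - s)" for k
    unfolding w using N2 by (simp add: abs_mult mult_left_mono divide_right_mono)
  have "A powr - s * r (Suc k) powr - s \<le> (1 - eigval k) powr - s" for k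
  proof -
    have "(A * r (Suc k)) powr - s \<le> (1 - eigval k) powr - s"
      using A(2)[of k] one_minus_eigval_pos[of k] assms by (intro powr_mono2') auto
    then show ?thesis using A(1) rate_pos[of k] by (simp add: powr_mult)
  qed
  then have "A powr - s * ((1 / real N) ^ k * r (Suc k) powr - s) \<le> (1 / real N) ^ k * (1 - eigval k) powr - s" for k
    using mult_left_mono[of "A powr - s * r (Suc k) powr - s" "(1 - eigval k) powr - s" "(1 / real N) ^ k"]
    by (simp add: mult_ac)
  moreover have "(1 / real N) ^ k * (1 - eigval k) powr - s = real N / (real N - 1) * (weight k * (1 - eigval k) powr - s)" for k
    unfolding w using N2 by simp
  ultimately have *: "A powr - s * ((1 / real N) ^ k * r (Suc k) powr - s) \<le>
      real N / (real N - 1) * (weight k * (1 - eigval k) powr - s)" for k by simp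
  have 2: "norm ((1 / real N) ^ k * r (Suc k) powr - s) \<le>
      A powr s * (real N / (real N - 1) * (weight k * (1 - eigval k) powr - s))" for k
  proof -
    have "A powr s * A powr - s = 1" using A(1) by (simp flip: powr_add)
    then show ?thesis
      using mult_left_mono[OF *[of k], of "A powr s"] by (simp add: mult.assoc[symmetric])
  qed
  show ?thesis
  proof
    assume "summable (\<lambda>k. weight k * (1 - eigval k) powr - s)"
    then show "summable (\<lambda>k. (1 / real N) ^ k * r (Suc k) powr - s)"
      by (intro summable_comparison_test'[OF _ 2] summable_mult)
  next
    assume "summable (\<lambda>k. (1 / real N) ^ k * r (Suc k) powr - s)"
    then show "summable (\<lambda>k. weight k * (1 - eigval k) powr - s)"
      by (intro summable_comparison_test'[OF _ 1] summable_mult)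
  qed
qed

text \<open>Ratio test: consecutive terms have limiting ratio N to the power s / \<mu> - 1, which is
  below 1.\<close>

lemma summable_weight_below:
  assumes "0 < s" "s < \<mu>"
  shows "summable (\<lambda>k. weight k * (1 - eigval k) powr - s)"
proof -
  have "(1 / real N) * L powr - s = real N powr (s / \<mu> - 1)"
    using N2 by (simp add: L_powr powr_diff)
  also have "\<dots> < 1" using assms N2 by (simp add: powr_less_one)
  finally have "(1 / real N) * L powr - s < 1" .
  then show ?thesis
    unfolding summable_weight_iff[OF assms(1)] using N2 rate_pos
    by (intro summable_of_ratio_lim[OF _ powr_ratio_lim[OF rate_pos rate_ratio L(1)]])
       (auto intro!: mult_pos_pos simp: less_imp_neq[symmetric])
qed

text \<open>For s > \<mu> the product N * L powr s is below 1, so the powers of the rates decay at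
  least as fast as the weights.\<close>

lemma weight_ge_above:
  assumes "s > \<mu>"
  shows "\<exists>\<theta>>0. \<forall>k. \<theta> * (1 - eigval k) powr s \<le> weight k"
proof -
  obtain A where A: "A > 0" "\<And>k. 1 - eigval k \<le> A * r (Suc k)" using one_minus_eigval_comparable by blast
  have "real N * L powr s = real N powr (1 - s / \<mu>)"
    using N2 by (simp add: L_powr powr_diff powr_minus divide_inverse)
  also have "\<dots> < 1" using assms N2 \<mu>_pos by (simp add: powr_less_one)
  finally have "real N * L powr s < 1" .
  then obtain C where C: "C > 0" "\<And>k. r (Suc k) powr s \<le> C * (1 / real N) ^ k"
    using powr_le_of_ratio[OF rate_pos rate_ratio L(1), of "real N" s] N2 by auto
  \<comment> \<open>Chosen so that the chain of estimates ends exactly in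
    \<open>weight k\<close>.\<close>
  define \<theta> where "\<theta> = (real N - 1) / (real N * (C * A powr s))"
  have "\<theta> * (1 - eigval k) powr s \<le> weight k" for k
  proof -
    have "(1 - eigval k) powr s \<le> (A * r (Suc k)) powr s"
      using A one_minus_eigval_pos[of k] assms \<mu>_pos by (intro powr_mono2) (auto intro: less_imp_le)
    also have "\<dots> = A powr s * r (Suc k) powr s" using A rate_pos[of k] by (simp add: powr_mult)
    also have "\<dots> \<le> A powr s * (C * (1 / real N) ^ k)" by (intro mult_left_mono C) simp
    finally have "\<theta> * (1 - eigval k) powr s \<le> \<theta> * (A powr s * (C * (1 / real N) ^ k))"
      using N2 C(1) by (intro mult_left_mono) (auto simp: \<theta>_def)
    also have "\<dots> = weight k" using N2 C(1) A(1) by (simp add: \<theta>_def weight_def power_divide)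
    finally show ?thesis .
  qed
  moreover have "\<theta> > 0" using N2 C(1) A(1) by (simp add: \<theta>_def)
  ultimately show ?thesis by blast
qed

lemma not_summable_weight_above:
  assumes "s > \<mu>"
  shows "\<not> summable (\<lambda>k. weight k * (1 - eigval k) powr - s)"
proof
  assume "summable (\<lambda>k. weight k * (1 - eigval k) powr - s)"
  then have lim: "(\<lambda>k. weight k * (1 - eigval k) powr - s) \<longlonglongrightarrow> 0" by (rule summable_LIMSEQ_zero)
  obtain \<theta> where \<theta>: "\<theta> > 0" "\<And>k. \<theta> * (1 - eigval k) powr s \<le> weight k"
    using weight_ge_above[OF assms] by blast
  have "\<theta> \<le> weight k * (1 - eigval k) powr - s" for k
    using \<theta>(2)[of k] one_minus_eigval_pos[of k] by (simp add: powr_minus field_simps)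
  then have "\<theta> \<le> 0" by (intro LIMSEQ_le_const[OF lim]) auto
  with \<theta>(1) show False by simp
qed

text \<open>At the exponent \<mu> the powers of N cancel exactly and leave a constant multiple of
  \<open>c k powr - \<mu>\<close>.\<close>

lemma summable_weight_critical:
  "summable (\<lambda>k. weight k * (1 - eigval k) powr - \<mu>) \<longleftrightarrow> summable (\<lambda>j. c j powr - \<mu>)"
proof -
  have "(1 / real N) ^ k * r (Suc k) powr - \<mu> = D powr - \<mu> * c k powr - \<mu>" for k
  proof -
    have "r (Suc k) powr - \<mu> = D powr - \<mu> * c k powr - \<mu> * real N powr real k"
      using D_pos c_pos[of k] \<mu>_pos by (simp add: rate powr_mult powr_powr)
    then show ?thesis using N2 by (simp add: powr_realpow power_divide)
  qed
  then show ?thesis using summable_weight_iff[OF \<mu>_pos] D_pos by (simp add: summable_cmult_iff)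
qed

section \<open>The degree of the walk\<close>

lemma potential_degree_eq: "potential_degree (trans_prob M N hold step) \<Omega> = ereal (\<mu> - 1)"
  unfolding potential_degree_def
proof (rule Sup_eqI)
  fix y assume "y \<in> ereal ` {\<zeta>. - 1 < \<zeta> \<and> finite_potential (trans_prob M N hold step) \<Omega> (\<zeta> + 1)}"
  then obtain \<zeta> where \<zeta>: "y = ereal \<zeta>" "\<zeta> > - 1" "finite_potential (trans_prob M N hold step) \<Omega> (\<zeta> + 1)"
    by auto
  then have "summable (\<lambda>k. weight k * (1 - eigval k) powr - (\<zeta> + 1))"
    using finite_potential_iff[of "\<zeta> + 1"] by simp
  then have "\<not> \<zeta> + 1 > \<mu>" using not_summable_weight_above by blast
  then show "y \<le> ereal (\<mu> - 1)" using \<zeta> by simp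
next
  fix y assume y: "\<And>z. z \<in> ereal ` {\<zeta>. - 1 < \<zeta> \<and> finite_potential (trans_prob M N hold step) \<Omega> (\<zeta> + 1)} \<Longrightarrow> z \<le> y"
  have *: "ereal \<zeta> \<le> y" if "-1 < \<zeta>" "\<zeta> < \<mu> - 1" for \<zeta>
    using that finite_potential_iff[of "\<zeta> + 1"] summable_weight_below[of "\<zeta> + 1"] by (intro y) auto
  show "ereal (\<mu> - 1) \<le> y"
  proof (cases y)
    case (real x)
    \<comment> \<open>Every \<zeta> strictly between -1 and \<mu> - 1 belongs to the set; this
      interval is nonempty since \<mu> > 0.\<close>
    have "\<mu> - 1 \<le> x" using * \<mu>_pos real by (intro dense_le_bounded[of "-1" "\<mu> - 1"]) auto
    then show ?thesis using real by simp
  next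
    case MInf
    then show ?thesis using *[of "\<mu> / 2 - 1"] \<mu>_pos by simp
  qed simp
qed

lemma potential_degree_plus_iff:
  "potential_degree_plus (trans_prob M N hold step) \<Omega> (\<mu> - 1) \<longleftrightarrow> summable (\<lambda>j. c j powr - \<mu>)"
  using finite_potential_iff[OF \<mu>_pos]
  by (simp add: potential_degree_plus_def potential_degree_eq summable_weight_critical)

section \<open>Finite and infinite moments of the return time\<close>

lemma one_minus_eigval_le_2: "1 - eigval k \<le> 2"
  using eigval_bounds(2,3)[of k] by linarith

lemma moment_finite:
  assumes "\<mu> < 1" "0 < \<delta>" "\<delta> < 1 - \<mu>"
  shows "moment M (return_time (walk N hold step origin) origin) \<delta> < \<infinity>"
proof -
  \<comment> \<open>Above \<mu>, so that the weights dominate the power s; below 1 - \<delta>, so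
    that the resulting decay exponent 1 - s of the avoidance probabilities exceeds \<delta>.\<close>
  obtain s where s: "\<mu> < s" "s < 1 - \<delta>" using dense[of \<mu> "1 - \<delta>"] assms by auto
  obtain A where A: "A > 0" "\<And>k. 1 - eigval k \<le> A * r (Suc k)" using one_minus_eigval_comparable by blast
  obtain \<kappa> where \<kappa>: "\<kappa> > 0" "\<And>k. \<kappa> * r (Suc k) \<le> r (Suc (Suc k))"
    using Suc_ge_ratio[OF rate_pos rate_ratio L(1)] by blast
  obtain \<theta> where \<theta>: "\<theta> > 0" "\<And>k. \<theta> * (1 - eigval k) powr s \<le> weight k"
    using weight_ge_above[OF s(1)] by blast
  have lim: "(\<lambda>k. 1 - eigval k) \<longlonglongrightarrow> 0"
  proof (rule tendsto_sandwich[OF _ _ tendsto_const])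
    have "(\<lambda>k. A * r (Suc k)) \<longlonglongrightarrow> A * 0"
      by (intro tendsto_intros summable_LIMSEQ_zero rate_summable)
    then show "(\<lambda>k. A * r (Suc k)) \<longlonglongrightarrow> 0" by simp
  qed (use A one_minus_eigval_pos[THEN less_imp_le] in simp_all)
  \<comment> \<open>Two-sided comparability transfers the ratio bound from the rates to the spectral
    gaps.\<close>
  have "\<kappa> / A * (1 - eigval k) \<le> 1 - eigval (Suc k)" for k
  proof -
    have "\<kappa> / A * (1 - eigval k) \<le> \<kappa> / A * (A * r (Suc k))"
      using A \<kappa> by (intro mult_left_mono) auto
    also have "\<dots> = \<kappa> * r (Suc k)" using A by simp
    also have "\<dots> \<le> 1 - eigval (Suc k)" using \<kappa>(2)[of k] eigval_bounds(1)[of "Suc k"] by linarith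
    finally show ?thesis .
  qed
  then obtain C where C: "C > 0" "\<And>m. C * real (Suc m) powr (1 - s) \<le> (\<Sum>n\<le>m. prob (visit n))"
    using partial_sums_lower[of weight "\<lambda>k. 1 - eigval k" "\<kappa> / A" \<theta> s "\<lambda>n. prob (visit n)"]
      weight_pos one_minus_eigval_pos one_minus_eigval_le_2 lim \<kappa>(1) A(1) \<theta> s \<mu>_pos prob_visit_sums
    by (auto simp: less_imp_le)
  have "prob (avoid 0 n) \<le> (1 / C) * real (Suc n) powr - (1 - s)" for n
  proof -
    have "C * real (Suc n) powr (1 - s) * prob (avoid 0 n) \<le> (\<Sum>k\<le>n. prob (visit k)) * prob (avoid 0 n)"
      by (intro mult_right_mono C) simp
    also have "\<dots> \<le> 1" by (rule prob_avoid_mult_le)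
    finally have "prob (avoid 0 n) \<le> 1 / (C * real (Suc n) powr (1 - s))"
      using C(1) by (subst pos_le_divide_eq) (auto simp: mult_ac)
    then show ?thesis by (simp only: powr_minus) (simp add: divide_inverse)
  qed
  then show ?thesis using assms s \<mu>_pos by (intro moment_return_time_finite[of \<delta> "1 - s" "1 / C"]) auto
qed

text \<open>With a finite moment the avoidance sums would be of order at most m to the power 1 - 2
  \<epsilon>, while the visit sums are of order at most m to the power \<epsilon>. Their product is
  at least m + 1, which is impossible for large m.\<close>

lemma moment_infinite:
  assumes "\<mu> = 1" "0 < \<delta>"
  shows "moment M (return_time (walk N hold step origin) origin) \<delta> = \<infinity>"
proof (rule ccontr)
  assume "moment M (return_time (walk N hold step origin) origin) \<delta> \<noteq> \<infinity>"
  then have fin: "moment M (return_time (walk N hold step origin) origin) \<delta> < \<infinity>"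
    by (simp add: top.not_eq_extremum)
  \<comment> \<open>Half the usable exponent, so that the product of the two bounds falls short of m
    by the power \<epsilon>.\<close>
  define \<epsilon> where "\<epsilon> = min \<delta> 1 / 2"
  have \<epsilon>: "0 < \<epsilon>" "\<epsilon> < 1" "min \<delta> 1 = 2 * \<epsilon>" using assms by (auto simp: \<epsilon>_def)
  obtain B where B: "\<And>m. (\<Sum>n\<le>m. prob (avoid 0 n)) \<le> B * real (Suc m) powr (1 - 2 * \<epsilon>)"
    using sum_prob_avoid_le_moment[OF assms(2) fin] \<epsilon> by auto
  have "summable (\<lambda>k. weight k * (1 - eigval k) powr - (1 - \<epsilon>))"
    using \<epsilon> assms by (intro summable_weight_below) auto
  then obtain C where C: "\<And>m. (\<Sum>n\<le>m. prob (visit n)) \<le> C * real (Suc m) powr \<epsilon>"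
    using partial_sums_upper[of weight "\<lambda>k. 1 - eigval k" "\<lambda>n. prob (visit n)" \<epsilon>]
      weight_pos one_minus_eigval_pos one_minus_eigval_le_2 prob_visit_sums \<epsilon>
    by (auto simp: less_imp_le)
  have "real (Suc m) powr \<epsilon> \<le> C * B" for m
  proof -
    let ?x = "real (Suc m)"
    have "?x \<le> (\<Sum>k\<le>m. prob (visit k)) * (\<Sum>n\<le>m. prob (avoid 0 n))" by (rule sum_prob_avoid_ge)
    also have "\<dots> \<le> (C * ?x powr \<epsilon>) * (B * ?x powr (1 - 2 * \<epsilon>))"
      by (intro mult_mono B C order_trans[OF _ C[of m]] sum_nonneg) auto
    also have "\<dots> = C * B * (?x powr \<epsilon> * ?x powr (1 - 2 * \<epsilon>))" by (simp add: mult_ac)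
    also have "?x powr \<epsilon> * ?x powr (1 - 2 * \<epsilon>) = ?x powr (1 - \<epsilon>)"
      unfolding powr_add[symmetric] by simp
    finally have "?x powr \<epsilon> * ?x powr (1 - \<epsilon>) \<le> C * B * ?x powr (1 - \<epsilon>)"
      unfolding powr_add[symmetric] by simp
    then show ?thesis by (subst (asm) mult_le_cancel_right_pos) auto
  qed
  with powr_Suc_unbounded[OF \<epsilon>(1), of "C * B"] show False by (meson not_le)
qed

end

theorem corollary3p2p5:
  fixes N :: nat and \<mu> :: real and c :: "nat \<Rightarrow> real" and M :: "'w measure"
    and hold :: "nat \<Rightarrow> 'w \<Rightarrow> real" and step :: "nat \<Rightarrow> 'w \<Rightarrow> nat \<Rightarrow> int"
  defines "p \<equiv> trans_prob M N hold step"
    and "\<Omega> \<equiv> carrier (hier_group N)"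
    and "T \<equiv> return_time (walk N hold step \<one>\<^bsub>hier_group N\<^esub>) \<one>\<^bsub>hier_group N\<^esub>"
  assumes "N \<ge> 2" and "\<mu> > 0"
    and "\<And>j. c j > 0"
    and "summable (\<lambda>j. c j * real N powr (- real j / \<mu>))"
    and "(INF j. c j) > 0"
    and "(\<lambda>j. c (Suc j) / c j) \<longlonglongrightarrow> 1"
    and "hierarchical_walk M N (mu_c_rate \<mu> c N) hold step"
  shows "(potential_degree p \<Omega> = ereal (\<mu> - 1) \<and>
          (potential_degree_plus p \<Omega> (\<mu> - 1) \<longleftrightarrow> summable (\<lambda>j. c j powr (- \<mu>)))) \<and>
         (\<mu> < 1 \<longrightarrow> (\<forall>\<delta>. 0 < \<delta> \<and> \<delta> < 1 - \<mu> \<longrightarrow> moment M T \<delta> < \<infinity>)) \<and>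
         (\<mu> = 1 \<longrightarrow> (\<forall>\<delta>>0. moment M T \<delta> = \<infinity>))"
proof -
  define D where "D = 1 / (\<Sum>i. c i * real N powr (- real i / \<mu>))"
  have "(\<Sum>i. c i * real N powr (- real i / \<mu>)) > 0"
    using assms(4,6,7) by (intro suminf_pos) auto
  then have D: "D > 0" by (simp add: D_def)
  interpret hierarchical_walk M N "mu_c_rate \<mu> c N" hold step by fact
  interpret mu_c_walk M N "mu_c_rate \<mu> c N" hold step \<mu> D c
    by unfold_locales (use assms D in \<open>auto simp: mu_c_rate_def D_def\<close>)
  show ?thesis
    unfolding p_def \<Omega>_def T_def
    using potential_degree_eq potential_degree_plus_iff moment_finite moment_infinite by blast
qed

end
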